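(* Let $S\subset\mathbb{R}^3$ be a connected orientable $\mathcal{C}^2$ surface with unit normal $N$, let $p\in S$, and let $B_r$ ($r\in\mathbb{R}\setminus\{0\}$) denote the ball of radius $|r|$ centered at $p+rN_p$. (1) Suppose that for some $r\neq 0$ the initial speed of $B_r$ is the same for three pairwise nonparallel directions in $T_pS$; that is, there are three unit-speed curves $\gamma_1,\gamma_2,\gamma_3$ in $S$ starting at $p$, with $\gamma_1'(0),\gamma_2'(0),\gamma_3'(0)\in T_pS$ pairwise nonparallel, such that $B_r$ rolls on $S$ along (an initial subarc of) each $\gamma_i$ and the three corresponding initial speeds are equal. Then either $p$ is an umbilic point of $S$, or the mean curvature of $S$ with respect to $N$ equals $1/r$ at $p$. (2) Conversely, suppose that the mean curvature $h$ of $S$ at $p$ with respect to $N$ is nonzero. If $p$ is umbilic, then $B_r$ rolls isotropically from $p$ for all $r\in\mathbb{R}\setminus\{0\}$ with $r\neq 1/h$. If $p$ is not umbilic, then $B_r$ rolls isotropically from $p$ for $r=1/h$ and for no other $r\in\mathbb{R}\setminus\{0\}$.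
   Context: Surfaces and curvature. $S$ is a connected orientable $\mathcal{C}^2$ surface in $\mathbb{R}^3$ with chosen unit normal field $N$. Principal curvatures $\kappa_1,\kappa_2$ are taken with respect to $N$, with the sign convention that the normal curvature of a unit-speed curve $\gamma$ in $S$ is $\langle\gamma'',N\rangle$; the mean curvature is $(\kappa_1+\kappa_2)/2$; a point is umbilic if $\kappa_1=\kappa_2$ there. Curves are of class at least $\mathcal{C}^2$. The ball. For $p\in S$ and a real number $r\neq 0$ (possibly negative), $B_r$ is the ball of radius $|r|$ centered at $p+rN_p$. The object that actually rolls is its boundary sphere $\widetilde S=\partial B_r$, which is tangent to $S$ at $p$. Intersections between $B_r$ and $S$ are allowed. Rolling. Let $\gamma\colon[0,\ell]\to S$ be a unit-speed curve with $\gamma(0)=p$. A motion of $\widetilde S$ on $S$ along $\gamma$ is a smooth (it suffices: continuously differentiable in $t$) one-parameter family $f_t$, $t\in[0,\ell]$, of direct isometries $f_t(x)=A_tx+b_t$ of $\mathbb{R}^3$ with $f_0=\mathrm{id}$ such that $f_t(\widetilde S)$ is tangent to $S$ at $\gamma(t)$ for every $t$. Its instantaneous motion at $t$ is the vector field $X_t(x)=f_t'(f_t^{-1}(x))=Q_tx+v_t$, where the prime denotes the $t$-derivative, $Q_t=A_t'A_t^T$ is skew-symmetric and $v_t=b_t'-Q_tb_t$. The angular velocity $\omega_t$ is the vector with $Q_tx=\omega_t\times x$ for all $x$. The motion is rotational if for every $t$ one has $Q_t\neq 0$ and $X_t(\gamma(t))=0$. A rolling (without skidding or spinning) of $B_r$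 on $S$ along $\gamma$ is a rotational motion such that $\omega_t$ is tangent to $S$ at $\gamma(t)$ for every $t$. For the purposes here it suffices that a rolling exists along an arbitrarily short initial subarc $\gamma|_{[0,\varepsilon]}$, $\varepsilon>0$. Speed. The speed of $B_r$ at time $t$ while rolling along $\gamma$ is the length $\left|\frac{d}{dt}f_t(p+rN_p)\right|$ of the velocity of its center; the initial speed is the speed at $t=0$. Isotropic rolling. $B_r$ rolls isotropically from $p$ if its initial speed while rolling along a unit-speed curve $\gamma$ with $\gamma(0)=p$ does not depend on the direction $v=\gamma'(0)\in T_pS$; i.e. there is a constant $\sigma$ such that for every unit vector $v\in T_pS$ and every unit-speed curve $\gamma$ in $S$ with $\gamma(0)=p$, $\gamma'(0)=v$, the ball $B_r$ rolls on $S$ along an initial subarc of $\gamma$, with initial speed $\sigma$. *)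

theory Defs
  imports "HOL-Analysis.Analysis"
begin

section \<open>Curves and surfaces\<close>

text \<open>All intervals below are closed and nondegenerate; derivatives are taken within the
  interval, hence one-sided at its end points.\<close>

definition velocity :: "real set \<Rightarrow> (real \<Rightarrow> 'a::real_normed_vector) \<Rightarrow> real \<Rightarrow> 'a" where
  "velocity I \<gamma> t = vector_derivative \<gamma> (at t within I)"

definition C1_curve_on :: "real set \<Rightarrow> (real \<Rightarrow> 'a::real_normed_vector) \<Rightarrow> bool" where
  "C1_curve_on I \<gamma> \<longleftrightarrow> \<gamma> differentiable_on I \<and> continuous_on I (velocity I \<gamma>)"

definition C2_curve_on :: "real set \<Rightarrow> (real \<Rightarrow> 'a::real_normed_vector) \<Rightarrow> bool" where
  "C2_curve_on I \<gamma> \<longleftrightarrow> C1_curve_on I \<gamma> \<and> C1_curve_on I (velocity I \<gamma>)"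

definition C2_map_on :: "'a::real_normed_vector set \<Rightarrow> ('a \<Rightarrow> 'b::real_normed_vector) \<Rightarrow> bool" where
  "C2_map_on U f \<longleftrightarrow>
     (\<exists>(f' :: 'a \<Rightarrow> 'a \<Rightarrow>\<^sub>L 'b) (f'' :: 'a \<Rightarrow> 'a \<Rightarrow>\<^sub>L 'a \<Rightarrow>\<^sub>L 'b).
        (\<forall>x\<in>U. (f has_derivative blinfun_apply (f' x)) (at x) \<and>
               (f' has_derivative blinfun_apply (f'' x)) (at x)) \<and>
        continuous_on U f'')"

text \<open>Surfaces are embedded: every point has a neighbourhood in \<open>S\<close> that is the homeomorphic
  image of an open plane set under an immersion of class \<open>C\<^sup>2\<close>.\<close>

definition C2_surface :: "(real^3) set \<Rightarrow> bool" where
  "C2_surface S \<longleftrightarrow>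
     (\<forall>q\<in>S. \<exists>W (U :: (real^2) set) X Y.
        openin (top_of_set S) W \<and> q \<in> W \<and> open U \<and> homeomorphism U W X Y \<and>
        C2_map_on U X \<and> (\<forall>u\<in>U. inj (frechet_derivative X (at u))))"

definition tangent_space :: "(real^3) set \<Rightarrow> real^3 \<Rightarrow> (real^3) set" where
  "tangent_space S q =
     {v. \<exists>e>0. \<exists>\<alpha>. C2_curve_on {-e..e} \<alpha> \<and> \<alpha> ` {-e..e} \<subseteq> S \<and> \<alpha> 0 = q \<and>
                   velocity {-e..e} \<alpha> 0 = v}"

text \<open>On a surface of class \<open>C\<^sup>2\<close>, a continuous unit normal field is automatically of
  class \<open>C\<^sup>1\<close>. The existence of such a field is orientability. Values of \<open>N\<close> off \<open>S\<close> are
  irrelevant.\<close>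

definition unit_normal_field :: "(real^3) set \<Rightarrow> (real^3 \<Rightarrow> real^3) \<Rightarrow> bool" where
  "unit_normal_field S N \<longleftrightarrow>
     continuous_on S N \<and> (\<forall>q\<in>S. norm (N q) = 1 \<and> (\<forall>v\<in>tangent_space S q. orthogonal (N q) v))"

definition unit_speed_curve :: "(real^3) set \<Rightarrow> real \<Rightarrow> (real \<Rightarrow> real^3) \<Rightarrow> bool" where
  "unit_speed_curve S l \<gamma> \<longleftrightarrow>
     0 < l \<and> C2_curve_on {0..l} \<gamma> \<and> \<gamma> ` {0..l} \<subseteq> S \<and>
     (\<forall>t\<in>{0..l}. norm (velocity {0..l} \<gamma> t) = 1)"


section \<open>Curvatures\<close>

definition normal_curvatures :: "(real^3) set \<Rightarrow> (real^3 \<Rightarrow> real^3) \<Rightarrow> real^3 \<Rightarrow> real set" where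
  "normal_curvatures S N q =
     {velocity {0..l} (velocity {0..l} \<gamma>) 0 \<bullet> N q | l \<gamma>. unit_speed_curve S l \<gamma> \<and> \<gamma> 0 = q}"

text \<open>The principal curvatures are the maximum and the minimum of the normal curvature; both
  are attained, since the normal curvature of a curve depends only on its unit tangent vector,
  and does so continuously.\<close>

definition principal_curvature1 :: "(real^3) set \<Rightarrow> (real^3 \<Rightarrow> real^3) \<Rightarrow> real^3 \<Rightarrow> real" where
  "principal_curvature1 S N q = (GREATEST k. k \<in> normal_curvatures S N q)"

definition principal_curvature2 :: "(real^3) set \<Rightarrow> (real^3 \<Rightarrow> real^3) \<Rightarrow> real^3 \<Rightarrow> real" where
  "principal_curvature2 S N q = (LEAST k. k \<in> normal_curvatures S N q)"

definition mean_curvature :: "(real^3) set \<Rightarrow> (real^3 \<Rightarrow> real^3) \<Rightarrow> real^3 \<Rightarrow> real" where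
  "mean_curvature S N q = (principal_curvature1 S N q + principal_curvature2 S N q) / 2"

definition umbilic :: "(real^3) set \<Rightarrow> (real^3 \<Rightarrow> real^3) \<Rightarrow> real^3 \<Rightarrow> bool" where
  "umbilic S N q \<longleftrightarrow> principal_curvature1 S N q = principal_curvature2 S N q"


section \<open>Rolling\<close>

definition ball_center :: "(real^3 \<Rightarrow> real^3) \<Rightarrow> real^3 \<Rightarrow> real \<Rightarrow> real^3" where
  "ball_center N p r = p + r *\<^sub>R N p"

definition rolling_sphere :: "(real^3 \<Rightarrow> real^3) \<Rightarrow> real^3 \<Rightarrow> real \<Rightarrow> (real^3) set" where
  "rolling_sphere N p r = sphere (ball_center N p r) \<bar>r\<bar>"

definition tangent_at :: "(real^3) set \<Rightarrow> (real^3) set \<Rightarrow> real^3 \<Rightarrow> bool" where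
  "tangent_at S' S q \<longleftrightarrow> q \<in> S' \<and> q \<in> S \<and> tangent_space S' q = tangent_space S q"

definition rigid :: "(real \<Rightarrow> real^3^3) \<Rightarrow> (real \<Rightarrow> real^3) \<Rightarrow> real \<Rightarrow> real^3 \<Rightarrow> real^3" where
  "rigid A b t x = A t *v x + b t"

definition motion ::
  "(real^3) set \<Rightarrow> (real^3) set \<Rightarrow> (real \<Rightarrow> real^3) \<Rightarrow> real \<Rightarrow>
   (real \<Rightarrow> real^3^3) \<Rightarrow> (real \<Rightarrow> real^3) \<Rightarrow> bool" where
  "motion S' S \<gamma> l A b \<longleftrightarrow>
     C1_curve_on {0..l} A \<and> C1_curve_on {0..l} b \<and>
     (\<forall>t\<in>{0..l}. rotation_matrix (A t)) \<and> rigid A b 0 = id \<and>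
     (\<forall>t\<in>{0..l}. tangent_at (rigid A b t ` S') S (\<gamma> t))"

definition instantaneous_motion ::
  "real \<Rightarrow> (real \<Rightarrow> real^3^3) \<Rightarrow> (real \<Rightarrow> real^3) \<Rightarrow> real \<Rightarrow> real^3 \<Rightarrow> real^3" where
  "instantaneous_motion l A b t x = velocity {0..l} (\<lambda>s. rigid A b s (inv (rigid A b t) x)) t"

text \<open>The linear part of the affine vector field \<open>instantaneous_motion l A b t\<close>.\<close>

definition rotational_part :: "real \<Rightarrow> (real \<Rightarrow> real^3^3) \<Rightarrow> real \<Rightarrow> real^3^3" where
  "rotational_part l A t = velocity {0..l} A t ** transpose (A t)"

definition angular_velocity :: "real \<Rightarrow> (real \<Rightarrow> real^3^3) \<Rightarrow> real \<Rightarrow> real^3" where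
  "angular_velocity l A t = (THE \<omega>. \<forall>x. rotational_part l A t *v x = cross3 \<omega> x)"

definition rotational_motion ::
  "(real^3) set \<Rightarrow> (real^3) set \<Rightarrow> (real \<Rightarrow> real^3) \<Rightarrow> real \<Rightarrow>
   (real \<Rightarrow> real^3^3) \<Rightarrow> (real \<Rightarrow> real^3) \<Rightarrow> bool" where
  "rotational_motion S' S \<gamma> l A b \<longleftrightarrow>
     motion S' S \<gamma> l A b \<and>
     (\<forall>t\<in>{0..l}. rotational_part l A t \<noteq> 0 \<and> instantaneous_motion l A b t (\<gamma> t) = 0)"

definition rolling ::
  "(real^3) set \<Rightarrow> (real^3) set \<Rightarrow> (real \<Rightarrow> real^3) \<Rightarrow> real \<Rightarrow>
   (real \<Rightarrow> real^3^3) \<Rightarrow> (real \<Rightarrow> real^3) \<Rightarrow> bool" where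
  "rolling S' S \<gamma> l A b \<longleftrightarrow>
     rotational_motion S' S \<gamma> l A b \<and>
     (\<forall>t\<in>{0..l}. angular_velocity l A t \<in> tangent_space S (\<gamma> t))"

definition speed :: "real \<Rightarrow> (real \<Rightarrow> real^3^3) \<Rightarrow> (real \<Rightarrow> real^3) \<Rightarrow> real^3 \<Rightarrow> real \<Rightarrow> real" where
  "speed l A b c t = norm (velocity {0..l} (\<lambda>s. rigid A b s c) t)"

text \<open>The ball rolls along an initial subarc of the curve \<open>\<gamma>\<close>, defined on \<open>{0..l}\<close> and starting
  at \<open>p\<close>, with initial speed \<open>\<sigma>\<close>.\<close>

definition rolls_with_initial_speed ::
  "(real^3) set \<Rightarrow> (real^3 \<Rightarrow> real^3) \<Rightarrow> real^3 \<Rightarrow> real \<Rightarrow> (real \<Rightarrow> real^3) \<Rightarrow> real \<Rightarrow> real \<Rightarrow> bool" where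
  "rolls_with_initial_speed S N p r \<gamma> l \<sigma> \<longleftrightarrow>
     (\<exists>\<epsilon> A b. 0 < \<epsilon> \<and> \<epsilon> \<le> l \<and> rolling (rolling_sphere N p r) S \<gamma> \<epsilon> A b \<and>
              speed \<epsilon> A b (ball_center N p r) 0 = \<sigma>)"

definition rolls_isotropically ::
  "(real^3) set \<Rightarrow> (real^3 \<Rightarrow> real^3) \<Rightarrow> real^3 \<Rightarrow> real \<Rightarrow> bool" where
  "rolls_isotropically S N p r \<longleftrightarrow>
     (\<exists>\<sigma>. \<forall>v\<in>tangent_space S p. norm v = 1 \<longrightarrow>
        (\<forall>l \<gamma>. unit_speed_curve S l \<gamma> \<and> \<gamma> 0 = p \<and> velocity {0..l} \<gamma> 0 = v \<longrightarrow>
               rolls_with_initial_speed S N p r \<gamma> l \<sigma>))"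

definition nonparallel :: "real^3 \<Rightarrow> real^3 \<Rightarrow> bool" where
  "nonparallel u v \<longleftrightarrow> \<not> collinear {0, u, v}"

end

theory Submission
  imports Defs
begin

text \<open>
  The speed of the rolling ball is governed by its center alone. Tangency at \<open>\<gamma> t\<close> forces the center
  to be \<open>\<gamma> t + r N (\<gamma> t)\<close> (\<open>rolling_center\<close>), so the initial speed in the direction \<open>v\<close> is the length of
  \<open>v + r DN v\<close>, however the sphere turns (\<open>initial_speed\<close>). Write \<open>W = - DN\<close> for the shape operator,
  \<open>II v = \<langle>W v, v\<rangle>\<close> for its quadratic form, \<open>h\<close> for the mean curvature and \<open>K\<close> for the determinant of \<open>W\<close>.
  The Cayley-Hamilton theorem \<open>W\<^sup>2 = 2 h W - K\<close> turns the squared speed for a unit vector \<open>v\<close> into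
  \<open>1 - r\<^sup>2 K + 2 r (h r - 1) II v\<close> (\<open>norm_center_velocity\<close>).

  If three pairwise nonparallel directions have the same speed, then either \<open>h r = 1\<close>, or \<open>II\<close> takes one
  value \<open>k\<close> on the three unit vectors. In the second case the quadratic form \<open>II - k \<langle>\<cdot>,\<cdot>\<rangle>\<close> has three zeros
  on the projective line, so it vanishes and \<open>p\<close> is umbilic (\<open>equal_speeds_imp\<close>). The same argument
  excludes isotropic rolling with \<open>r \<noteq> 1 / h\<close> at a nonumbilic point, since the surface contains a
  unit-speed curve in every tangent direction (\<open>unit_speed_curve_exists\<close>).

  Conversely, the formula shows that the speed is the same in all directions if \<open>p\<close> is umbilic or
  \<open>r = 1 / h\<close>: it is \<open>\<bar>1 - r h\<bar>\<close> in the first case, and its square is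
  \<open>(h\<^sup>2 - K) / h\<^sup>2\<close> in the second. It remains to see that the ball rolls at all. Rolling prescribes
  the angular velocity \<open>\<omega> = (N \<times> c') / r\<close>, where \<open>c'\<close> is the velocity of the center, and the rotations
  solve the linear equation \<open>A' x = \<omega> \<times> A x\<close>; on a short interval a solution exists by the
  contraction principle. The resulting motion is rotational as long as \<open>c' \<noteq> 0\<close>, that is, on a short
  interval whenever the initial speed is positive (\<open>rolling_exists\<close>).

  All this rests on two facts about a surface of class \<open>C\<^sup>2\<close> that are read off from a chart: its
  continuous unit normal field is continuously differentiable along the surface, with a derivative that
  is symmetric on the tangent plane (\<open>normal_field_differentiable\<close>), and the tangent plane is the
  orthogonal complement of the normal (\<open>tangent_space_perp_normal\<close>). Together with the curves in all
  directions they identify the normal curvatures at \<open>p\<close> with the values of \<open>II\<close> on unit vectors, whose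
  extremes are \<open>h\<close> plus and minus the square root of \<open>h\<^sup>2 - K\<close> (\<open>principal_curvatures\<close>).
\<close>

section \<open>Symmetry of second derivatives\<close>

text \<open>The second difference of \<open>f\<close> along \<open>h\<close> and \<open>k\<close> does not depend on the order of \<open>h\<close> and \<open>k\<close>,
  while the mean value theorem, applied first along \<open>h\<close> and then along \<open>k\<close>, evaluates it as a
  second derivative taken in that order.\<close>

lemma second_difference_mean_value:
  fixes f :: "'a::real_normed_vector \<Rightarrow> real"
  assumes t: "0 < t"
    and mem: "\<And>a b. 0 \<le> a \<Longrightarrow> a \<le> t \<Longrightarrow> 0 \<le> b \<Longrightarrow> b \<le> t \<Longrightarrow> x + a *\<^sub>R h + b *\<^sub>R k \<in> U"
    and f1: "\<And>y. y \<in> U \<Longrightarrow> (f has_derivative f' y) (at y)"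
    and f2: "\<And>y. y \<in> U \<Longrightarrow> ((\<lambda>y. f' y h) has_derivative (\<lambda>w. f'' y w h)) (at y)"
  obtains a b where "0 < a" "a < t" "0 < b" "b < t"
    "f (x + t *\<^sub>R h + t *\<^sub>R k) - f (x + t *\<^sub>R h) - f (x + t *\<^sub>R k) + f x
       = t\<^sup>2 * f'' (x + a *\<^sub>R h + b *\<^sub>R k) k h"
proof -
  define g where "g a = f (x + a *\<^sub>R h + t *\<^sub>R k) - f (x + a *\<^sub>R h)" for a
  define g' where "g' a = f' (x + a *\<^sub>R h + t *\<^sub>R k) h - f' (x + a *\<^sub>R h) h" for a
  have g: "(g has_derivative (\<lambda>s. s * g' a)) (at a within {0..t})" if "0 \<le> a" "a \<le> t" for a
  proof -
    have y1: "x + a *\<^sub>R h + t *\<^sub>R k \<in> U" and y2: "x + a *\<^sub>R h \<in> U"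
      using mem[of a t] mem[of a 0] that t by auto
    have "bounded_linear (f' (x + a *\<^sub>R h + t *\<^sub>R k))" "bounded_linear (f' (x + a *\<^sub>R h))"
      using f1[OF y1] f1[OF y2] has_derivative_bounded_linear by auto
    then have sc: "f' (x + a *\<^sub>R h + t *\<^sub>R k) (s *\<^sub>R h) = s * f' (x + a *\<^sub>R h + t *\<^sub>R k) h"
      "f' (x + a *\<^sub>R h) (s *\<^sub>R h) = s * f' (x + a *\<^sub>R h) h" for s
      by (simp_all add: bounded_linear.linear linear_cmul)
    have "((\<lambda>a. f (x + a *\<^sub>R h + t *\<^sub>R k)) has_derivative
             (\<lambda>s. f' (x + a *\<^sub>R h + t *\<^sub>R k) (s *\<^sub>R h))) (at a within {0..t})"
      by (rule has_derivative_compose[of "\<lambda>a. x + a *\<^sub>R h + t *\<^sub>R k", OF _ f1[OF y1]])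
        (auto intro!: derivative_eq_intros)
    moreover have "((\<lambda>a. f (x + a *\<^sub>R h)) has_derivative
             (\<lambda>s. f' (x + a *\<^sub>R h) (s *\<^sub>R h))) (at a within {0..t})"
      by (rule has_derivative_compose[of "\<lambda>a. x + a *\<^sub>R h", OF _ f1[OF y2]])
        (auto intro!: derivative_eq_intros)
    ultimately show ?thesis
      unfolding g_def[abs_def] g'_def
      by (rule has_derivative_diff[THEN has_derivative_eq_rhs]) (simp add: sc right_diff_distrib)
  qed
  from mvt_simple[OF t g] obtain a where a: "0 < a" "a < t" "g t - g 0 = t * g' a"
    by auto
  define G where "G b = f' (x + a *\<^sub>R h + b *\<^sub>R k) h" for b
  have G: "(G has_derivative (\<lambda>s. s * f'' (x + a *\<^sub>R h + b *\<^sub>R k) k h)) (at b within {0..t})"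
    if "0 \<le> b" "b \<le> t" for b
  proof -
    have y: "x + a *\<^sub>R h + b *\<^sub>R k \<in> U"
      using mem[of a b] that a by auto
    have "linear (\<lambda>w. f'' (x + a *\<^sub>R h + b *\<^sub>R k) w h)"
      using f2[OF y] has_derivative_linear by blast
    then have sc: "f'' (x + a *\<^sub>R h + b *\<^sub>R k) (s *\<^sub>R k) h = s * f'' (x + a *\<^sub>R h + b *\<^sub>R k) k h" for s
      using linear_cmul by force
    have "((\<lambda>b. f' (x + a *\<^sub>R h + b *\<^sub>R k) h) has_derivative
             (\<lambda>s. f'' (x + a *\<^sub>R h + b *\<^sub>R k) (s *\<^sub>R k) h)) (at b within {0..t})"
      by (rule has_derivative_compose[of "\<lambda>b. x + a *\<^sub>R h + b *\<^sub>R k", OF _ f2[OF y]])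
        (auto intro!: derivative_eq_intros)
    then show ?thesis
      unfolding G_def[abs_def] by (simp add: sc)
  qed
  from mvt_simple[OF t G] obtain b where b: "0 < b" "b < t"
    "G t - G 0 = t * f'' (x + a *\<^sub>R h + b *\<^sub>R k) k h"
    by auto
  have "g t - g 0 = t * (G t - G 0)"
    using a by (simp add: G_def g'_def)
  with b have "g t - g 0 = t\<^sup>2 * f'' (x + a *\<^sub>R h + b *\<^sub>R k) k h"
    by (simp add: power2_eq_square)
  then show thesis
    using that[OF a(1,2) b(1,2)] by (simp add: g_def algebra_simps)
qed

text \<open>The two orders of differentiation give the same second difference at points that can be taken
  arbitrarily close to \<open>x\<close>; continuity of the second derivative carries the equality to \<open>x\<close>.\<close>

lemma second_derivative_symmetric:
  fixes f :: "'a::real_normed_vector \<Rightarrow> real"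
  assumes U: "open U" "x \<in> U"
    and f1: "\<And>y. y \<in> U \<Longrightarrow> (f has_derivative f' y) (at y)"
    and f2: "\<And>y w. y \<in> U \<Longrightarrow> ((\<lambda>y. f' y w) has_derivative (\<lambda>z. f'' y z w)) (at y)"
    and cont: "\<And>z w. continuous_on U (\<lambda>y. f'' y z w)"
  shows "f'' x h k = f'' x k h"
proof (rule ccontr)
  assume ne: "f'' x h k \<noteq> f'' x k h"
  define e where "e = \<bar>f'' x h k - f'' x k h\<bar> / 2"
  have e: "e > 0"
    using ne by (simp add: e_def)
  obtain d0 where d0: "d0 > 0" "ball x d0 \<subseteq> U"
    using U openE by blast
  have "isCont (\<lambda>y. f'' y h k) x" "isCont (\<lambda>y. f'' y k h) x"
    using cont U continuous_on_eq_continuous_at by blast+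
  then obtain d1 d2 where d1: "d1 > 0" "\<And>y. dist y x < d1 \<Longrightarrow> dist (f'' y h k) (f'' x h k) < e"
    and d2: "d2 > 0" "\<And>y. dist y x < d2 \<Longrightarrow> dist (f'' y k h) (f'' x k h) < e"
    using e unfolding continuous_at_eps_delta by metis
  define d where "d = min d0 (min d1 d2)"
  define t where "t = d / (2 * (norm h + norm k + 1))"
  have d: "d > 0"
    using d0 d1 d2 by (simp add: d_def)
  have pos: "norm h + norm k + 1 > 0"
    by (smt (verit) norm_ge_zero)
  have t: "t > 0"
    using d pos by (simp add: t_def)
  have near: "dist (x + a *\<^sub>R h + b *\<^sub>R k) x < d" if "0 \<le> a" "a \<le> t" "0 \<le> b" "b \<le> t" for a b
  proof -
    have "dist (x + a *\<^sub>R h + b *\<^sub>R k) x \<le> norm (a *\<^sub>R h) + norm (b *\<^sub>R k)"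
      by (simp add: dist_norm norm_triangle_ineq add.assoc del: norm_scaleR)
    also have "\<dots> \<le> t * norm h + t * norm k"
      using that by (intro add_mono) (auto simp: mult_right_mono)
    also have "\<dots> < 2 * t * (norm h + norm k + 1)"
      using t by (simp add: algebra_simps) (smt (verit) mult_nonneg_nonneg norm_ge_zero)
    also have "\<dots> = d"
      using pos unfolding t_def by (simp add: divide_simps)
    finally show ?thesis .
  qed
  have mem: "x + a *\<^sub>R h + b *\<^sub>R k \<in> U" if "0 \<le> a" "a \<le> t" "0 \<le> b" "b \<le> t" for a b
    using near[OF that] d0 by (auto simp: d_def dist_commute subset_eq)
  have mem': "x + b *\<^sub>R k + a *\<^sub>R h \<in> U" if "0 \<le> b" "b \<le> t" "0 \<le> a" "a \<le> t" for a b
    using mem[of a b] that by (simp add: algebra_simps)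
  obtain a b where ab: "0 < a" "a < t" "0 < b" "b < t"
    "f (x + t *\<^sub>R h + t *\<^sub>R k) - f (x + t *\<^sub>R h) - f (x + t *\<^sub>R k) + f x
       = t\<^sup>2 * f'' (x + a *\<^sub>R h + b *\<^sub>R k) k h"
    using second_difference_mean_value[of t x h k U f f' f'', OF t mem f1 f2] by blast
  obtain b' a' where ab': "0 < b'" "b' < t" "0 < a'" "a' < t"
    "f (x + t *\<^sub>R k + t *\<^sub>R h) - f (x + t *\<^sub>R k) - f (x + t *\<^sub>R h) + f x
       = t\<^sup>2 * f'' (x + b' *\<^sub>R k + a' *\<^sub>R h) h k"
    using second_difference_mean_value[of t x k h U f f' f'', OF t mem' f1 f2] by blast
  \<comment> \<open>Both sides are the same second difference.\<close>
  have "t\<^sup>2 * f'' (x + a *\<^sub>R h + b *\<^sub>R k) k h = t\<^sup>2 * f'' (x + a' *\<^sub>R h + b' *\<^sub>R k) h k"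
    using ab(5) ab'(5) by (simp add: algebra_simps)
  then have eq: "f'' (x + a *\<^sub>R h + b *\<^sub>R k) k h = f'' (x + a' *\<^sub>R h + b' *\<^sub>R k) h k"
    using t by simp
  have "dist (f'' (x + a *\<^sub>R h + b *\<^sub>R k) k h) (f'' x k h) < e"
    using near[of a b] ab by (intro d2) (auto simp: d_def)
  moreover have "dist (f'' (x + a' *\<^sub>R h + b' *\<^sub>R k) h k) (f'' x h k) < e"
    using near[of a' b'] ab' by (intro d1) (auto simp: d_def)
  ultimately show False
    unfolding eq e_def dist_real_def by (smt (verit) field_sum_of_halves)
qed

section \<open>Local solutions of ordinary differential equations\<close>

text \<open>The Picard operator is a contraction when the length of the interval times the Lipschitz constant
  is below 1. It acts here on bounded continuous functions on the whole line, a complete space;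
  the image of such a function is extended beyond the interval by constants. Continuity of \<open>F\<close> is assumed
  only along continuous functions, which is the form in which the integral equation uses it.\<close>

lemma Lipschitz_ode_local_solution:
  fixes F :: "real \<Rightarrow> 'a::banach \<Rightarrow> 'a"
  assumes e: "0 < e"
    and cont: "\<And>x. continuous_on {0..e} x \<Longrightarrow> continuous_on {0..e} (\<lambda>t. F t (x t))"
    and K: "\<And>t x y. t \<in> {0..e} \<Longrightarrow> norm (F t x - F t y) \<le> K * norm (x - y)"
    and small: "0 \<le> K" "e * K < 1"
  obtains x where "x 0 = x0"
    "\<And>t. t \<in> {0..e} \<Longrightarrow> (x has_vector_derivative F t (x t)) (at t within {0..e})"
proof -
  define P where "P x t = x0 + integral {0..t} (\<lambda>s. F s (x s))" for x t
  have contP: "continuous_on (cbox 0 e) (P x)" if "continuous_on {0..e} x" for x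
  proof -
    have "(\<lambda>s. F s (x s)) integrable_on {0..e}"
      using cont[OF that] integrable_continuous_real by blast
    then show ?thesis
      unfolding P_def[abs_def]
      using indefinite_integral_continuous_1 by (auto intro!: continuous_intros)
  qed
  have "\<exists>g::real \<Rightarrow>\<^sub>C 'a. \<forall>t. g t = P (apply_bcontfun x) (clamp 0 e t)" for x :: "real \<Rightarrow>\<^sub>C 'a"
    using continuous_on_cbox_bcontfunE[OF contP[of "apply_bcontfun x"]] by (metis continuous_on_apply_bcontfun)
  then obtain T :: "(real \<Rightarrow>\<^sub>C 'a) \<Rightarrow> (real \<Rightarrow>\<^sub>C 'a)"
    where T: "\<And>x t. T x t = P x (clamp 0 e t)"
    by metis
  have cl: "clamp 0 e t \<in> {0..e}" for t
    using clamp_in_interval[of "0::real" e t] e by auto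
  have lip: "dist (T x) (T y) \<le> (e * K) * dist x y" for x y
  proof (rule dist_bound)
    fix t
    define s where "s = clamp 0 e t"
    have s: "0 \<le> s" "s \<le> e"
      using cl[of t] by (auto simp: s_def)
    have int: "(\<lambda>u. F u (apply_bcontfun z u)) integrable_on {0..s}" for z :: "real \<Rightarrow>\<^sub>C 'a"
      using continuous_on_subset[OF cont[of "apply_bcontfun z"], of "{0..s}"] s
      by (auto intro: integrable_continuous_real)
    have "dist (T x t) (T y t) = norm (integral {0..s} (\<lambda>u. F u (x u) - F u (y u)))"
      by (simp add: T P_def dist_norm integral_diff int flip: s_def)
    also have "\<dots> \<le> integral {0..s} (\<lambda>u. K * dist x y)"
    proof (rule integral_norm_bound_integral)
      show "norm (F u (x u) - F u (y u)) \<le> K * dist x y" if "u \<in> {0..s}" for u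
      proof -
        have "norm (F u (x u) - F u (y u)) \<le> K * dist (x u) (y u)"
          using K[of u] that s by (auto simp: dist_norm)
        also have "\<dots> \<le> K * dist x y"
          using small by (intro mult_left_mono dist_bounded)
        finally show ?thesis .
      qed
    qed (auto intro: integrable_diff int)
    also have "\<dots> = s * (K * dist x y)"
      using s by simp
    also have "\<dots> \<le> e * (K * dist x y)"
      using s small by (intro mult_right_mono) auto
    finally show "dist (T x t) (T y t) \<le> (e * K) * dist x y"
      by (simp add: mult.assoc)
  qed
  have "0 \<le> e * K"
    using e small by simp
  from banach_fix_type[OF this small(2)] lip obtain x where x: "T x = x"
    by blast
  have xt: "x t = P x t" if "t \<in> {0..e}" for t
  proof -
    have "x t = P x (clamp 0 e t)"
      using T x by metis
    then show ?thesis
      using that by simp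
  qed
  show thesis
  proof
    show "x 0 = x0"
      using xt[of 0] e by (simp add: P_def)
    fix t assume t: "t \<in> {0..e}"
    have "(P x has_vector_derivative F t (x t)) (at t within {0..e})"
      unfolding P_def[abs_def]
      using integral_has_vector_derivative[OF cont[of "apply_bcontfun x"] t]
      by (auto intro!: derivative_eq_intros)
    then show "(x has_vector_derivative F t (x t)) (at t within {0..e})"
      by (rule has_vector_derivative_transform[OF t, rotated]) (simp add: xt)
  qed
qed

section \<open>Velocities of curves\<close>

lemma velocity_eq:
  assumes "a < b" "t \<in> {a..b}" "(\<gamma> has_vector_derivative d) (at t within {a..b})"
  shows "velocity {a..b} \<gamma> t = d"
  using vector_derivative_within_cbox[of a b t \<gamma> d] assms by (simp add: velocity_def)

lemma has_velocity:
  assumes "C1_curve_on I \<gamma>" "t \<in> I"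
  shows "(\<gamma> has_vector_derivative velocity I \<gamma> t) (at t within I)"
  using assms vector_derivative_works unfolding C1_curve_on_def velocity_def differentiable_on_def
  by blast

lemma C1_curve_onI:
  assumes "a < b" and "\<And>t. t \<in> {a..b} \<Longrightarrow> (\<gamma> has_vector_derivative \<gamma>' t) (at t within {a..b})"
    and "continuous_on {a..b} \<gamma>'"
  shows "C1_curve_on {a..b} \<gamma>"
proof -
  have "velocity {a..b} \<gamma> t = \<gamma>' t" if "t \<in> {a..b}" for t
    using velocity_eq assms that by blast
  then show ?thesis
    using assms unfolding C1_curve_on_def differentiable_on_def
    by (metis continuous_on_cong differentiableI_vector)
qed

lemma C2_curve_onI:
  assumes "a < b" and "\<And>t. t \<in> {a..b} \<Longrightarrow> (\<gamma> has_vector_derivative \<gamma>' t) (at t within {a..b})"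
    and "\<And>t. t \<in> {a..b} \<Longrightarrow> (\<gamma>' has_vector_derivative \<gamma>'' t) (at t within {a..b})"
    and "continuous_on {a..b} \<gamma>''"
  shows "C2_curve_on {a..b} \<gamma>"
proof -
  have v: "velocity {a..b} \<gamma> t = \<gamma>' t" if "t \<in> {a..b}" for t
    using velocity_eq assms that by blast
  have "continuous_on {a..b} \<gamma>'"
    using assms has_vector_derivative_continuous continuous_on_eq_continuous_within by blast
  then have "C1_curve_on {a..b} \<gamma>"
    using C1_curve_onI assms by blast
  moreover have "(velocity {a..b} \<gamma> has_vector_derivative \<gamma>'' t) (at t within {a..b})"
    if "t \<in> {a..b}" for t
    using assms(3)[OF that] v that by (metis has_vector_derivative_transform)
  then have "C1_curve_on {a..b} (velocity {a..b} \<gamma>)"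
    using C1_curve_onI assms by blast
  ultimately show ?thesis
    by (simp add: C2_curve_on_def)
qed

section \<open>Derivatives of products and of normalized vectors\<close>

lemma bounded_bilinear_cross3: "bounded_bilinear cross3"
  using bilinear_cross bilinear_conv_bounded_bilinear by blast

text \<open>Cramer's rule for the vectors \<open>x\<close>, \<open>y\<close> and \<open>x \<times> y\<close>: it gives the coordinates of a vector in the
  plane of \<open>x\<close> and \<open>y\<close> as quotients that depend continuously on \<open>x\<close> and \<open>y\<close>.\<close>

lemma cross3_Cramer:
  "(cross3 w y \<bullet> cross3 x y) *\<^sub>R x + (cross3 x w \<bullet> cross3 x y) *\<^sub>R y + (w \<bullet> cross3 x y) *\<^sub>R cross3 x y
     = (cross3 x y \<bullet> cross3 x y) *\<^sub>R w"
  by (simp add: cross3_def inner_vec_def sum_3 vec_eq_iff forall_3 vector_def; algebra)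

lemma has_derivative_sgn:
  fixes n :: "'a::real_normed_vector \<Rightarrow> 'b::real_inner"
  assumes n: "(n has_derivative n') (at x within A)" and "n x \<noteq> 0"
  shows "((\<lambda>x. sgn (n x)) has_derivative
           (\<lambda>h. (n' h - (sgn (n x) \<bullet> n' h) *\<^sub>R sgn (n x)) /\<^sub>R norm (n x))) (at x within A)"
proof -
  have norm: "((\<lambda>x. norm (n x)) has_derivative (\<lambda>h. n' h \<bullet> sgn (n x))) (at x within A)"
    using has_derivative_compose[OF n has_derivative_norm] assms by simp
  have "((\<lambda>x. inverse (norm (n x)) *\<^sub>R n x) has_derivative
       (\<lambda>h. inverse (norm (n x)) *\<^sub>R n' h
          + (- (inverse (norm (n x)) * (n' h \<bullet> sgn (n x)) * inverse (norm (n x)))) *\<^sub>R n x)) (at x within A)"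
    using assms by (intro has_derivative_scaleR[OF Deriv.has_derivative_inverse[OF _ norm] n]) auto
  then show ?thesis
    unfolding sgn_div_norm
    by (rule has_derivative_eq_rhs)
      (use assms in \<open>auto simp: fun_eq_iff inner_commute algebra_simps divide_simps\<close>)
qed

section \<open>Charts of a surface\<close>

locale surface_chart =
  fixes S W :: "(real^3) set" and U :: "(real^2) set"
    and X :: "real^2 \<Rightarrow> real^3" and Y :: "real^3 \<Rightarrow> real^2"
    and X' :: "real^2 \<Rightarrow> (real^2) \<Rightarrow>\<^sub>L (real^3)" and X'' :: "real^2 \<Rightarrow> (real^2) \<Rightarrow>\<^sub>L (real^2) \<Rightarrow>\<^sub>L (real^3)"
  assumes W: "openin (top_of_set S) W" and U: "open U" and homeo: "homeomorphism U W X Y"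
    and X: "\<And>u. u \<in> U \<Longrightarrow> (X has_derivative X' u) (at u)"
    and X': "\<And>u. u \<in> U \<Longrightarrow> (X' has_derivative X'' u) (at u)"
    and X'': "continuous_on U X''"
    and inj: "\<And>u. u \<in> U \<Longrightarrow> inj (X' u)"
begin

definition X1 where "X1 u = X' u (axis 1 1)"
definition X2 where "X2 u = X' u (axis 2 1)"
definition n where "n u = cross3 (X1 u) (X2 u)"

text \<open>The left inverse of \<open>X' u\<close> that annihilates the normal direction, that is, the coordinates of the
  tangential part of \<open>w\<close> in the basis \<open>X1 u\<close>, \<open>X2 u\<close>. It serves as the derivative of the chart \<open>Y\<close>
  along \<open>S\<close>; the explicit formula makes its continuous dependence on \<open>u\<close> evident.\<close>

definition L :: "real^2 \<Rightarrow> real^3 \<Rightarrow> real^2" where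
  "L u w = vector [cross3 w (X2 u) \<bullet> n u / (n u \<bullet> n u), cross3 (X1 u) w \<bullet> n u / (n u \<bullet> n u)]"

lemma X'_expand: "X' u h = h $ 1 *\<^sub>R X1 u + h $ 2 *\<^sub>R X2 u"
proof -
  have "h = h $ 1 *\<^sub>R axis 1 1 + h $ 2 *\<^sub>R axis 2 1"
    by (simp add: vec_eq_iff forall_2 axis_def)
  then have "X' u h = X' u (h $ 1 *\<^sub>R axis 1 1 + h $ 2 *\<^sub>R axis 2 1)"
    by simp
  then show ?thesis
    by (simp add: blinfun.add_right blinfun.scaleR_right X1_def X2_def)
qed

lemma n_nonzero:
  assumes "u \<in> U"
  shows "n u \<noteq> 0"
proof
  assume "n u = 0"
  then have "collinear {0, X1 u, X2 u}"
    by (simp add: n_def cross_eq_0)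
  then consider "X1 u = 0" | "X2 u = 0" | c where "X2 u = c *\<^sub>R X1 u"
    using collinear_lemma by blast
  then obtain h :: "real^2" where "h \<noteq> 0" "X' u h = 0"
  proof cases
    case 1
    then show thesis
      by (intro that[of "axis 1 1"]) (auto simp: X1_def)
  next
    case 2
    then show thesis
      by (intro that[of "axis 2 1"]) (auto simp: X2_def)
  next
    case (3 c)
    then show thesis
      by (intro that[of "vector [c, -1]"]) (auto simp: X'_expand vec_eq_iff forall_2 vector_2)
  qed
  moreover have "X' u 0 = 0"
    by simp
  ultimately show False
    using inj[OF assms] injD by metis
qed

lemma L_X':
  assumes "u \<in> U"
  shows "L u (X' u h) = h"
proof -
  have "cross3 (X' u h) (X2 u) = h $ 1 *\<^sub>R n u" "cross3 (X1 u) (X' u h) = h $ 2 *\<^sub>R n u"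
    by (simp_all add: X'_expand n_def cross_add_left cross_mult_left cross_add_right cross_mult_right)
  then show ?thesis
    unfolding L_def using n_nonzero[OF assms] by (simp add: vec_eq_iff[where 'b=2] forall_2 vector_2)
qed

lemma X'_L:
  assumes "u \<in> U" and "w \<bullet> n u = 0"
  shows "X' u (L u w) = w"
proof -
  let ?d = "n u \<bullet> n u"
  have d: "?d \<noteq> 0"
    using n_nonzero assms by simp
  have "X' u (L u w) = ((cross3 w (X2 u) \<bullet> n u) *\<^sub>R X1 u + (cross3 (X1 u) w \<bullet> n u) *\<^sub>R X2 u) /\<^sub>R ?d"
    by (simp add: X'_expand L_def vector_2 divide_inverse_commute scaleR_add_right)
  also have "(cross3 w (X2 u) \<bullet> n u) *\<^sub>R X1 u + (cross3 (X1 u) w \<bullet> n u) *\<^sub>R X2 u = ?d *\<^sub>R w"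
    using cross3_Cramer[of w "X2 u" "X1 u"] assms by (simp add: n_def)
  finally show ?thesis
    using d by simp
qed

lemma X'_perp_n: "X' u h \<bullet> n u = 0"
  by (simp add: X'_expand n_def inner_add_left dot_cross_self)

lemma range_X': "u \<in> U \<Longrightarrow> range (X' u) = {w. w \<bullet> n u = 0}"
  using X'_L X'_perp_n by (auto, metis rangeI)

lemma linear_L: "linear (L u)"
  by (rule linearI)
    (simp_all add: L_def vec_eq_iff forall_2 vector_2 cross_add_left cross_add_right cross_mult_left
       cross_mult_right inner_add_left add_divide_distrib)

lemma Y_in_U: "q \<in> W \<Longrightarrow> Y q \<in> U" and X_Y: "q \<in> W \<Longrightarrow> X (Y q) = q"
  using homeo by (auto simp: homeomorphism_def)

lemma at_within_W:
  assumes "q \<in> W"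
  shows "at q within W = at q within S"
proof -
  obtain T where "open T" "W = S \<inter> T"
    using W by (auto simp: openin_open)
  then show ?thesis
    using assms by (intro at_within_nhd[of q T]) auto
qed

text \<open>A continuous inverse of an immersion is differentiable along the image. The reason is
  that an immersion shrinks small displacements at most by a fixed factor.\<close>

lemma Y_has_derivative:
  assumes "q \<in> W"
  shows "(Y has_derivative L (Y q)) (at q within S)"
proof -
  have "(Y has_derivative L (Y q)) (at (X (Y q)) within X ` U)"
  proof (rule has_derivative_inverse_within)
    show "(X has_derivative X' (Y q)) (at (Y q) within U)"
      using X Y_in_U assms has_derivative_at_withinI by blast
    have "continuous_on W Y"
      using homeo by (auto simp: homeomorphism_def)
    then show "continuous (at (X (Y q)) within X ` U) Y"
      using homeo assms X_Y by (auto simp: homeomorphism_def continuous_on_eq_continuous_within)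
    show "L (Y q) \<circ> X' (Y q) = id"
      using L_X' Y_in_U assms by auto
  qed (use homeo linear_L Y_in_U assms in \<open>auto simp: homeomorphism_def\<close>)
  moreover have "X ` U = W"
    using homeo by (auto simp: homeomorphism_def)
  ultimately show ?thesis
    using at_within_W X_Y assms by simp
qed

text \<open>Along \<open>S\<close> the identity coincides near \<open>q\<close> with \<open>X \<circ> Y\<close>, whose derivative has its values in the
  range of \<open>X'\<close>. The curve may be one-sided at \<open>t\<close>, as it is at the end points of its interval.\<close>

lemma velocity_in_range:
  assumes "q \<in> W" and "t \<in> I" "at t within I \<noteq> bot" and "\<gamma> ` I \<subseteq> S" "\<gamma> t = q"
    and v: "(\<gamma> has_vector_derivative v) (at t within I)"
  shows "v \<in> range (X' (Y q))"
proof -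
  have "((\<lambda>z. X (Y z)) has_derivative (\<lambda>w. X' (Y q) (L (Y q) w))) (at q within S)"
    using has_derivative_compose[OF Y_has_derivative[OF assms(1)] X[OF Y_in_U]] assms by blast
  then have "((\<lambda>z. X (Y z)) has_derivative (\<lambda>w. X' (Y q) (L (Y q) w))) (at q within W)"
    using at_within_W assms by simp
  then have "((\<lambda>z. z) has_derivative (\<lambda>w. X' (Y q) (L (Y q) w))) (at q within W)"
    by (rule has_derivative_transform[OF assms(1), rotated]) (simp add: X_Y)
  then have "((\<lambda>z. z) has_derivative (\<lambda>w. X' (Y q) (L (Y q) w))) (at (\<gamma> t) within \<gamma> ` I)"
    using at_within_W assms has_derivative_subset by metis
  from vector_derivative_diff_chain_within[OF v this]
  have "(\<gamma> has_vector_derivative X' (Y q) (L (Y q) v)) (at t within I)"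
    by (simp add: o_def)
  then have "v = X' (Y q) (L (Y q) v)"
    using vector_derivative_unique_within assms by blast
  then show ?thesis
    by blast
qed

lemma line_in_U:
  assumes "u \<in> U"
  obtains e where "e > 0" "\<And>s. \<bar>s\<bar> \<le> e \<Longrightarrow> u + s *\<^sub>R h \<in> U"
proof -
  obtain d where d: "d > 0" "ball u d \<subseteq> U"
    using U assms openE by blast
  define e where "e = d / (2 * (norm h + 1))"
  have pos: "norm h + 1 > 0"
    by (smt (verit) norm_ge_zero)
  have e: "e > 0"
    using d pos by (simp add: e_def)
  have "u + s *\<^sub>R h \<in> U" if "\<bar>s\<bar> \<le> e" for s
  proof -
    have "norm (s *\<^sub>R h) \<le> e * norm h"
      using that by (simp add: mult_right_mono)
    also have "\<dots> < 2 * e * (norm h + 1)"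
      using e by (simp add: algebra_simps) (smt (verit) mult_nonneg_nonneg norm_ge_zero)
    also have "\<dots> = d"
      using pos unfolding e_def by (simp add: divide_simps)
    finally show ?thesis
      using d by (auto simp: dist_norm subset_eq)
  qed
  with e show thesis
    using that by blast
qed

lemma X_line:
  assumes "u + s *\<^sub>R h \<in> U"
  shows "((\<lambda>s. X (u + s *\<^sub>R h)) has_vector_derivative X' (u + s *\<^sub>R h) h) (at s within A)"
    and "((\<lambda>s. X' (u + s *\<^sub>R h) h) has_vector_derivative X'' (u + s *\<^sub>R h) h h) (at s within A)"
proof -
  have *: "((\<lambda>s. u + s *\<^sub>R h) has_vector_derivative h) (at s within A)"
    by (auto intro!: derivative_eq_intros simp: has_vector_derivative_def)
  have "(X has_derivative X' (u + s *\<^sub>R h)) (at (u + s *\<^sub>R h) within (\<lambda>s. u + s *\<^sub>R h) ` A)"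
    using X assms has_derivative_at_withinI by blast
  from vector_derivative_diff_chain_within[OF * this]
  show "((\<lambda>s. X (u + s *\<^sub>R h)) has_vector_derivative X' (u + s *\<^sub>R h) h) (at s within A)"
    by (simp add: o_def)
  have "((\<lambda>v. X' v h) has_derivative (\<lambda>w. X'' (u + s *\<^sub>R h) w h)) (at (u + s *\<^sub>R h) within (\<lambda>s. u + s *\<^sub>R h) ` A)"
    using X'[OF assms] has_derivative_at_withinI
    by (auto intro!: derivative_eq_intros)
  from vector_derivative_diff_chain_within[OF * this]
  show "((\<lambda>s. X' (u + s *\<^sub>R h) h) has_vector_derivative X'' (u + s *\<^sub>R h) h h) (at s within A)"
    by (simp add: o_def)
qed

lemma X''_line_continuous:
  assumes "\<And>s. s \<in> A \<Longrightarrow> u + s *\<^sub>R h \<in> U"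
  shows "continuous_on A (\<lambda>s. X'' (u + s *\<^sub>R h) h h)"
proof -
  have "continuous_on A (\<lambda>s. X'' (u + s *\<^sub>R h))"
    by (rule continuous_on_compose2[OF X'']) (use assms in \<open>auto intro!: continuous_intros\<close>)
  then show ?thesis
    by (auto intro!: continuous_intros)
qed

text \<open>Images of straight lines in the parameter domain realize every vector in the range of \<open>X'\<close>.\<close>

lemma tangent_space_eq_range:
  assumes q: "q \<in> W"
  shows "tangent_space S q = range (X' (Y q))"
proof
  show "tangent_space S q \<subseteq> range (X' (Y q))"
  proof
    fix v assume "v \<in> tangent_space S q"
    then obtain e \<alpha> where *: "e > 0" "C2_curve_on {-e..e} \<alpha>" "\<alpha> ` {-e..e} \<subseteq> S" "\<alpha> 0 = q"
      "velocity {-e..e} \<alpha> 0 = v"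
      unfolding tangent_space_def by blast
    have "(\<alpha> has_vector_derivative v) (at 0 within {-e..e})"
      using has_velocity[of "{-e..e}" \<alpha> 0] * by (auto simp: C2_curve_on_def)
    moreover have "at 0 within {-e..e} \<noteq> bot"
      using * by (simp add: at_within_Icc_at)
    ultimately show "v \<in> range (X' (Y q))"
      using velocity_in_range[OF q, of 0 "{-e..e}"] * by auto
  qed
  show "range (X' (Y q)) \<subseteq> tangent_space S q"
  proof
    fix v assume "v \<in> range (X' (Y q))"
    then obtain h where h: "v = X' (Y q) h"
      by blast
    obtain e where e: "e > 0" "\<And>s. \<bar>s\<bar> \<le> e \<Longrightarrow> Y q + s *\<^sub>R h \<in> U"
      using line_in_U[OF Y_in_U[OF q]] by metis
    have mem: "Y q + s *\<^sub>R h \<in> U" if "s \<in> {-e..e}" for s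
      using e(2)[of s] that by auto
    have "C2_curve_on {-e..e} (\<lambda>s. X (Y q + s *\<^sub>R h))"
      by (rule C2_curve_onI[OF _ X_line[OF mem] X''_line_continuous[OF mem]]) (use e in auto)
    moreover have "velocity {-e..e} (\<lambda>s. X (Y q + s *\<^sub>R h)) 0 = v"
      using e mem X_line(1)[of "Y q" 0 h] Y_in_U[OF q] by (intro velocity_eq) (auto simp: h)
    moreover have "(\<lambda>s. X (Y q + s *\<^sub>R h)) ` {-e..e} \<subseteq> S"
      using mem homeo W by (force simp: homeomorphism_def openin_open)
    ultimately show "v \<in> tangent_space S q"
      unfolding tangent_space_def using e X_Y[OF q]
      by (intro CollectI exI[of _ e] conjI exI[of _ "\<lambda>s. X (Y q + s *\<^sub>R h)"]) auto
  qed
qed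

end

lemma surface_chart_exists:
  assumes "C2_surface S" "p \<in> S"
  obtains W U X Y X' X'' where "surface_chart S W U X Y X' X''" "p \<in> W"
proof -
  obtain W U X Y where *: "openin (top_of_set S) W" "p \<in> W" "open (U :: (real^2) set)"
    "homeomorphism U W X Y" "C2_map_on U X" "\<And>u. u \<in> U \<Longrightarrow> inj (frechet_derivative X (at u))"
    using assms unfolding C2_surface_def by meson
  then obtain X' X'' where
    **: "\<And>u. u \<in> U \<Longrightarrow> (X has_derivative blinfun_apply (X' u)) (at u)"
    "\<And>u. u \<in> U \<Longrightarrow> (X' has_derivative blinfun_apply (X'' u)) (at u)" "continuous_on U X''"
    unfolding C2_map_on_def by meson
  have "inj (X' u)" if "u \<in> U" for u
    using *(6)[OF that] frechet_derivative_at[OF **(1)[OF that]] by simp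
  then have "surface_chart S W U X Y X' X''"
    using * ** by (intro surface_chart.intro) auto
  then show thesis
    using that * by blast
qed

section \<open>The derivative of the unit normal field\<close>

context surface_chart
begin

text \<open>The unit normal spans the orthogonal complement of the plane spanned by \<open>X1\<close> and \<open>X2\<close>, so it
  agrees with the normalized cross product up to a sign.\<close>

lemma normal_field_eq:
  assumes N: "unit_normal_field S N" and q: "q \<in> W"
  shows "N q = (N q \<bullet> sgn (n (Y q))) *\<^sub>R sgn (n (Y q))"
    and "\<bar>N q \<bullet> sgn (n (Y q))\<bar> = 1"
proof -
  let ?s = "sgn (n (Y q))"
  let ?w = "N q - (N q \<bullet> ?s) *\<^sub>R ?s"
  have qS: "q \<in> S"
    using q W openin_imp_subset by blast
  have s: "?s \<bullet> ?s = 1"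
    using n_nonzero[OF Y_in_U[OF q]] by (simp add: dot_square_norm norm_sgn)
  have ws: "?w \<bullet> ?s = 0"
    by (simp add: inner_diff_left s)
  then have wn: "?w \<bullet> n (Y q) = 0"
    using n_nonzero[OF Y_in_U[OF q]] by (simp add: sgn_div_norm)
  then have "?w \<in> tangent_space S q"
    using tangent_space_eq_range[OF q] range_X'[OF Y_in_U[OF q]] by auto
  then have "N q \<bullet> ?w = 0"
    using N qS by (auto simp: unit_normal_field_def orthogonal_def)
  then have "?w \<bullet> ?w = 0"
    using ws by (simp add: inner_diff_left inner_diff_right inner_commute)
  then show 1: "N q = (N q \<bullet> ?s) *\<^sub>R ?s"
    by simp
  have "norm (N q) = 1"
    using N qS by (auto simp: unit_normal_field_def)
  moreover have "norm ((N q \<bullet> ?s) *\<^sub>R ?s) = \<bar>N q \<bullet> ?s\<bar>"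
    using s by (simp add: norm_eq_1[symmetric])
  ultimately show "\<bar>N q \<bullet> ?s\<bar> = 1"
    using 1 by simp
qed

lemma tangent_space_eq_perp:
  assumes N: "unit_normal_field S N" and q: "q \<in> W"
  shows "tangent_space S q = {v. v \<bullet> N q = 0}"
proof -
  have "v \<bullet> N q = 0 \<longleftrightarrow> v \<bullet> n (Y q) = 0" for v
  proof -
    have "v \<bullet> N q = (N q \<bullet> sgn (n (Y q))) * (v \<bullet> sgn (n (Y q)))"
      using normal_field_eq(1)[OF assms] by (metis inner_scaleR_right)
    moreover have "N q \<bullet> sgn (n (Y q)) \<noteq> 0"
      using normal_field_eq(2)[OF assms] by auto
    ultimately show ?thesis
      using n_nonzero[OF Y_in_U[OF q]] by (simp add: sgn_div_norm)
  qed
  then show ?thesis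
    using tangent_space_eq_range[OF q] range_X'[OF Y_in_U[OF q]] by simp
qed

definition n' where
  "n' u h = cross3 (X1 u) (X'' u h (axis 2 1)) + cross3 (X'' u h (axis 1 1)) (X2 u)"

text \<open>The derivative of the Gauss map \<open>u \<mapsto> sgn (n u)\<close> in the coordinates of the chart.\<close>

definition \<nu>' where
  "\<nu>' u h = (n' u h - (sgn (n u) \<bullet> n' u h) *\<^sub>R sgn (n u)) /\<^sub>R norm (n u)"

lemma X'_apply_has_derivative:
  assumes "u \<in> U"
  shows "((\<lambda>v. X' v k) has_derivative (\<lambda>h. X'' u h k)) (at u)"
  using X'[OF assms] by (auto intro!: derivative_eq_intros)

lemma sgn_n_has_derivative:
  assumes "u \<in> U"
  shows "((\<lambda>u. sgn (n u)) has_derivative \<nu>' u) (at u)"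
proof -
  have "(n has_derivative n' u) (at u)"
    unfolding n_def[abs_def] n'_def[abs_def] X1_def[abs_def] X2_def[abs_def]
    by (rule bounded_bilinear.FDERIV[OF bounded_bilinear_cross3]) (rule X'_apply_has_derivative[OF assms])+
  then show ?thesis
    using has_derivative_sgn n_nonzero[OF assms] unfolding \<nu>'_def[abs_def] by blast
qed

lemma \<nu>'_perp:
  assumes "u \<in> U"
  shows "\<nu>' u h \<bullet> sgn (n u) = 0"
proof -
  have "sgn (n u) \<bullet> sgn (n u) = 1"
    using n_nonzero[OF assms] by (simp add: dot_square_norm norm_sgn)
  then show ?thesis
    by (simp add: \<nu>'_def inner_diff_left inner_commute[of "n' u h"])
qed

lemma continuous_X': "continuous_on U (\<lambda>u. X' u k)"
  by (intro continuous_at_imp_continuous_on ballI has_derivative_continuous[OF X'_apply_has_derivative])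

lemma continuous_n: "continuous_on U n"
  unfolding n_def[abs_def] X1_def[abs_def] X2_def[abs_def]
  by (intro continuous_on_cross continuous_X')

lemma continuous_L: "continuous_on U (\<lambda>u. L u w)"
proof -
  have L: "L u w = (cross3 w (X2 u) \<bullet> n u / (n u \<bullet> n u)) *\<^sub>R axis 1 1
      + (cross3 (X1 u) w \<bullet> n u / (n u \<bullet> n u)) *\<^sub>R axis 2 1" for u
    by (simp add: L_def vec_eq_iff forall_2 vector_2 axis_def)
  have "continuous_on U X1" "continuous_on U X2"
    unfolding X1_def[abs_def] X2_def[abs_def] by (rule continuous_X')+
  then show ?thesis
    unfolding L using n_nonzero
    by (intro continuous_intros continuous_on_cross continuous_n) auto
qed

lemma continuous_\<nu>'_L: "continuous_on U (\<lambda>u. \<nu>' u (L u w))"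
proof -
  have "continuous_on U X1" "continuous_on U X2"
    unfolding X1_def[abs_def] X2_def[abs_def] by (rule continuous_X')+
  then have "continuous_on U (\<lambda>u. n' u (L u w))"
    unfolding n'_def by (intro continuous_intros continuous_on_cross continuous_L X'')
  then show ?thesis
    unfolding \<nu>'_def using n_nonzero
    by (intro continuous_intros continuous_n) auto
qed

text \<open>Differentiating the orthogonality of \<open>sgn (n u)\<close> and \<open>X' u k\<close> expresses the derivative of the Gauss
  map by second derivatives of \<open>X\<close>.\<close>

lemma second_fundamental_form:
  assumes u: "u \<in> U"
  shows "\<nu>' u h \<bullet> X' u k = - (sgn (n u) \<bullet> X'' u h k)"
proof -
  have "((\<lambda>v. sgn (n v) \<bullet> X' v k) has_derivative (\<lambda>h. sgn (n u) \<bullet> X'' u h k + \<nu>' u h \<bullet> X' u k)) (at u)"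
    by (intro has_derivative_inner sgn_n_has_derivative X'_apply_has_derivative u)
  moreover have "((\<lambda>v. sgn (n v) \<bullet> X' v k) has_derivative (\<lambda>h. 0)) (at u)"
  proof (rule has_derivative_transform_within_open[OF has_derivative_const U u])
    show "0 = sgn (n v) \<bullet> X' v k" if "v \<in> U" for v
      using X'_perp_n[of v k] by (simp add: sgn_div_norm inner_commute)
  qed
  ultimately have "(\<lambda>h. sgn (n u) \<bullet> X'' u h k + \<nu>' u h \<bullet> X' u k) = (\<lambda>h. 0)"
    using has_derivative_unique by blast
  from fun_cong[OF this, of h] show ?thesis
    by simp
qed

lemma X''_symmetric:
  assumes u: "u \<in> U"
  shows "c \<bullet> X'' u h k = c \<bullet> X'' u k h"
proof (rule second_derivative_symmetric[of U u "\<lambda>u. c \<bullet> X u" "\<lambda>u w. c \<bullet> X' u w" "\<lambda>u z w. c \<bullet> X'' u z w"])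
  show "((\<lambda>u. c \<bullet> X u) has_derivative (\<lambda>w. c \<bullet> X' y w)) (at y)" if "y \<in> U" for y
    using X[OF that] by (rule has_derivative_inner_right)
  show "((\<lambda>u. c \<bullet> X' u w) has_derivative (\<lambda>z. c \<bullet> X'' y z w)) (at y)" if "y \<in> U" for y w
    using X'_apply_has_derivative[OF that] by (rule has_derivative_inner_right)
  show "continuous_on U (\<lambda>y. c \<bullet> X'' y z w)" for z w
    by (intro continuous_intros X'')
qed (use U u in auto)

text \<open>A continuous normal field is of class \<open>C\<^sup>1\<close> along \<open>S\<close>: the sign by which it differs from the
  normalized cross product is locally constant. Its derivative is symmetric on the tangent plane
  because the second derivative of \<open>X\<close> is.\<close>

lemma normal_field_differentiable:
  assumes N: "unit_normal_field S N" and p: "p \<in> W"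
  obtains V D where "openin (top_of_set S) V" "p \<in> V"
    "\<And>q. q \<in> V \<Longrightarrow> (N has_derivative blinfun_apply (D q)) (at q within S)"
    "continuous_on V D"
    "\<And>q w. q \<in> V \<Longrightarrow> D q w \<bullet> N q = 0"
    "\<And>a b. a \<bullet> N p = 0 \<Longrightarrow> b \<bullet> N p = 0 \<Longrightarrow> D p a \<bullet> b = a \<bullet> D p b"
proof -
  define \<sigma> where "\<sigma> q = N q \<bullet> sgn (n (Y q))" for q
  define V where "V = {q \<in> W. \<sigma> q = \<sigma> p}"
  define D where "D q = Blinfun (\<lambda>w. \<sigma> p *\<^sub>R \<nu>' (Y q) (L (Y q) w))" for q
  have YW: "continuous_on W Y" "Y ` W \<subseteq> U"
    using homeo by (auto simp: homeomorphism_def)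
  have WS: "W \<subseteq> S"
    using W openin_imp_subset by blast
  have "continuous_on W N"
    using N WS continuous_on_subset by (auto simp: unit_normal_field_def)
  moreover have "continuous_on W (\<lambda>q. n (Y q))"
    by (rule continuous_on_compose2[OF continuous_n YW])
  ultimately have c\<sigma>: "continuous_on W \<sigma>"
    unfolding \<sigma>_def[abs_def] using n_nonzero Y_in_U by (intro continuous_intros) auto
  have \<sigma>: "\<bar>\<sigma> q\<bar> = 1" if "q \<in> W" for q
    using normal_field_eq(2)[OF N that] by (simp add: \<sigma>_def)
  have "openin (top_of_set W) (W \<inter> \<sigma> -` ball (\<sigma> p) 1)"
    using c\<sigma> continuous_openin_preimage_gen open_ball by blast
  moreover have "W \<inter> \<sigma> -` ball (\<sigma> p) 1 = V"
  proof -
    have "\<sigma> q = \<sigma> p \<longleftrightarrow> dist (\<sigma> p) (\<sigma> q) < 1" if "q \<in> W" for q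
      using \<sigma>[OF that] \<sigma>[OF p] by (auto simp: dist_real_def)
    then show ?thesis
      by (auto simp: V_def)
  qed
  ultimately have V: "openin (top_of_set S) V"
    using W openin_trans by metis
  have VW: "V \<subseteq> W"
    by (auto simp: V_def)
  have pV: "p \<in> V"
    using p by (simp add: V_def)
  have N_eq: "N z = \<sigma> p *\<^sub>R sgn (n (Y z))" if "z \<in> V" for z
    using normal_field_eq(1)[OF N, of z] that by (auto simp: V_def \<sigma>_def)
  have der: "(N has_derivative (\<lambda>w. \<sigma> p *\<^sub>R \<nu>' (Y q) (L (Y q) w))) (at q within S)" if q: "q \<in> V" for q
  proof -
    have qW: "q \<in> W"
      using q VW by blast
    have "((\<lambda>q. \<sigma> p *\<^sub>R sgn (n (Y q))) has_derivative (\<lambda>w. \<sigma> p *\<^sub>R \<nu>' (Y q) (L (Y q) w))) (at q within S)"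
      using has_derivative_compose[OF Y_has_derivative[OF qW] sgn_n_has_derivative[OF Y_in_U[OF qW]]]
      by (intro has_derivative_scaleR_right)
    then have *: "((\<lambda>q. \<sigma> p *\<^sub>R sgn (n (Y q))) has_derivative (\<lambda>w. \<sigma> p *\<^sub>R \<nu>' (Y q) (L (Y q) w))) (at q within V)"
      using V has_derivative_subset openin_imp_subset by blast
    have "(N has_derivative (\<lambda>w. \<sigma> p *\<^sub>R \<nu>' (Y q) (L (Y q) w))) (at q within V)"
      using has_derivative_transform[OF q N_eq *] by blast
    moreover have "at q within V = at q within S"
    proof -
      obtain T where "open T" "V = S \<inter> T"
        using V by (auto simp: openin_open)
      then show ?thesis
        using q by (intro at_within_nhd[of q T]) auto
    qed
    ultimately show ?thesis
      by simp
  qed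
  have D: "blinfun_apply (D q) = (\<lambda>w. \<sigma> p *\<^sub>R \<nu>' (Y q) (L (Y q) w))" if "q \<in> V" for q
    unfolding D_def using der[OF that] has_derivative_bounded_linear bounded_linear_Blinfun_apply by blast
  show thesis
  proof (rule that[of V D])
    show "(N has_derivative blinfun_apply (D q)) (at q within S)" if "q \<in> V" for q
      using der[OF that] D[OF that] by simp
    show "continuous_on V D"
    proof (rule continuous_on_blinfun_componentwise)
      fix w :: "real^3"
      have "continuous_on V (\<lambda>q. \<nu>' (Y q) (L (Y q) w))"
        by (rule continuous_on_compose2[OF continuous_\<nu>'_L continuous_on_subset[OF YW(1) VW]])
          (use YW VW in auto)
      then have "continuous_on V (\<lambda>q. \<sigma> p *\<^sub>R \<nu>' (Y q) (L (Y q) w))"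
        by (intro continuous_intros)
      then show "continuous_on V (\<lambda>q. D q w)"
        by (subst continuous_on_cong[OF refl, where g = "\<lambda>q. \<sigma> p *\<^sub>R \<nu>' (Y q) (L (Y q) w)"])
          (auto simp: D)
    qed
    show "D q w \<bullet> N q = 0" if q: "q \<in> V" for q w
      using \<nu>'_perp[OF Y_in_U] q VW by (auto simp: D[OF q] N_eq[OF q])
    show "D p a \<bullet> b = a \<bullet> D p b" if ab: "a \<bullet> N p = 0" "b \<bullet> N p = 0" for a b
    proof -
      have u: "Y p \<in> U"
        using Y_in_U p by blast
      have "a \<in> range (X' (Y p))" "b \<in> range (X' (Y p))"
        using ab tangent_space_eq_perp[OF N p] tangent_space_eq_range[OF p] by auto
      then obtain h k where "a = X' (Y p) h" "b = X' (Y p) k"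
        by blast
      then show ?thesis
        using L_X'[OF u] second_fundamental_form[OF u, of h k] second_fundamental_form[OF u, of k h]
          X''_symmetric[OF u, of "sgn (n (Y p))" h k]
        by (simp add: D[OF pV] inner_commute)
    qed
  qed (use V pV in auto)
qed

end

text \<open>The tangent space is defined by curves through the point, which does not cover the one-sided
  velocity of a curve at an end point of its interval; the chart covers both cases.\<close>

lemma velocity_perp_normal:
  assumes S: "C2_surface S" and N: "unit_normal_field S N"
    and "t \<in> {a..b}" "a < b" "\<gamma> ` {a..b} \<subseteq> S"
    and "(\<gamma> has_vector_derivative v) (at t within {a..b})"
  shows "v \<bullet> N (\<gamma> t) = 0"
proof -
  have "\<gamma> t \<in> S"
    using assms by blast
  with S obtain W U X Y X' X'' where c: "surface_chart S W U X Y X' X''" "\<gamma> t \<in> W"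
    using surface_chart_exists by blast
  have "at t within {a..b} \<noteq> bot"
    using assms by (metis box_real(2) islimpt_Icc trivial_limit_within)
  then show ?thesis
    using surface_chart.velocity_in_range[OF c, of t "{a..b}" \<gamma> v]
      surface_chart.tangent_space_eq_range[OF c] surface_chart.tangent_space_eq_perp[OF c(1) N c(2)] assms
    by auto
qed

lemma tangent_space_perp_normal:
  assumes "C2_surface S" and "unit_normal_field S N" and "q \<in> S"
  shows "tangent_space S q = {v. v \<bullet> N q = 0}"
  using assms surface_chart_exists surface_chart.tangent_space_eq_perp by metis

section \<open>Curves of unit speed\<close>

text \<open>Arc length of a regular curve has the positive derivative \<open>norm (\<beta>' s)\<close>, so it can be inverted and
  the inverse inserted. The new velocity is the unit tangent field \<open>sgn \<circ> \<beta>'\<close> along the inverse,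
  and both are continuously differentiable.\<close>

lemma unit_speed_reparametrization:
  fixes \<beta> :: "real \<Rightarrow> 'a::real_inner"
  assumes e: "0 < e"
    and \<beta>: "\<And>s. s \<in> {0..e} \<Longrightarrow> (\<beta> has_vector_derivative \<beta>' s) (at s within {0..e})"
    and \<beta>': "\<And>s. s \<in> {0..e} \<Longrightarrow> (\<beta>' has_vector_derivative \<beta>'' s) (at s within {0..e})"
    and \<beta>'': "continuous_on {0..e} \<beta>''"
    and regular: "\<And>s. s \<in> {0..e} \<Longrightarrow> \<beta>' s \<noteq> 0"
  obtains l \<gamma> where "0 < l" "C2_curve_on {0..l} \<gamma>" "\<gamma> ` {0..l} \<subseteq> \<beta> ` {0..e}" "\<gamma> 0 = \<beta> 0"
    "\<And>t. t \<in> {0..l} \<Longrightarrow> norm (velocity {0..l} \<gamma> t) = 1" "velocity {0..l} \<gamma> 0 = sgn (\<beta>' 0)"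
proof -
  have c\<beta>': "continuous_on {0..e} \<beta>'"
    using \<beta>' has_vector_derivative_continuous continuous_on_eq_continuous_within by blast
  define len where "len s = integral {0..s} (\<lambda>x. norm (\<beta>' x))" for s
  have len: "(len has_real_derivative norm (\<beta>' s)) (at s within {0..e})" if "s \<in> {0..e}" for s
    unfolding len_def[abs_def]
    by (rule integral_has_real_derivative[OF _ that]) (intro continuous_intros c\<beta>')
  have clen: "continuous_on {0..e} len"
    using DERIV_continuous_on[OF len] .
  have less: "len x < len y" if "0 \<le> x" "x < y" "y \<le> e" for x y
  proof -
    have "(len has_derivative (\<lambda>h. norm (\<beta>' z) * h)) (at z within {x..y})" if "x \<le> z" "z \<le> y" for z
    proof -
      have "(len has_real_derivative norm (\<beta>' z)) (at z within {x..y})"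
        using that \<open>0 \<le> x\<close> \<open>y \<le> e\<close> by (intro has_field_derivative_subset[OF len]) auto
      then show ?thesis
        by (simp add: has_field_derivative_def)
    qed
    from mvt_simple[OF \<open>x < y\<close> this] obtain z
      where "z \<in> {x<..<y}" "len y - len x = norm (\<beta>' z) * (y - x)"
      by blast
    moreover from this have "norm (\<beta>' z) * (y - x) > 0"
      using regular[of z] that by simp
    ultimately show ?thesis
      by linarith
  qed
  define l where "l = len e"
  have len0: "len 0 = 0"
    by (simp add: len_def)
  have l: "0 < l"
    using less[of 0 e] e len0 by (simp add: l_def)
  have inj: "inj_on len {0..e}"
    by (rule linorder_inj_onI) (use less in \<open>auto, fastforce\<close>)
  have img: "len ` {0..e} = {0..l}"
  proof
    have "len x \<le> len y" if "0 \<le> x" "x \<le> y" "y \<le> e" for x y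
      using less[of x y] that by (cases "x = y") auto
    then show "len ` {0..e} \<subseteq> {0..l}"
      using len0 by (force simp: l_def)
    show "{0..l} \<subseteq> len ` {0..e}"
    proof
      fix y assume "y \<in> {0..l}"
      then obtain x where "0 \<le> x" "x \<le> e" "len x = y"
        using IVT'[of len 0 y e] clen e len0 by (auto simp: l_def)
      then show "y \<in> len ` {0..e}"
        by auto
    qed
  qed
  define \<phi> where "\<phi> = the_inv_into {0..e} len"
  have \<phi>len: "\<phi> (len s) = s" if "s \<in> {0..e}" for s
    using the_inv_into_f_f[OF inj that] by (simp add: \<phi>_def)
  have \<phi>mem: "\<phi> t \<in> {0..e}" "len (\<phi> t) = t" if "t \<in> {0..l}" for t
    using that \<phi>len unfolding img[symmetric] by auto
  have c\<phi>: "continuous_on {0..l} \<phi>"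
    using continuous_on_inv[OF clen compact_Icc] \<phi>len by (simp add: img)
  have \<phi>: "(\<phi> has_vector_derivative inverse (norm (\<beta>' (\<phi> t)))) (at t within {0..l})"
    if t: "t \<in> {0..l}" for t
  proof -
    have "(\<phi> has_derivative (\<lambda>h. inverse (norm (\<beta>' (\<phi> t))) * h)) (at (len (\<phi> t)) within len ` {0..e})"
    proof (rule has_derivative_inverse_within)
      show "(len has_derivative (\<lambda>h. norm (\<beta>' (\<phi> t)) * h)) (at (\<phi> t) within {0..e})"
        using len[OF \<phi>mem(1)[OF t]] by (simp add: has_field_derivative_def)
      show "continuous (at (len (\<phi> t)) within len ` {0..e}) \<phi>"
        using c\<phi> t \<phi>mem(2)[OF t] by (simp add: img continuous_on_eq_continuous_within)
      show "(\<lambda>h. inverse (norm (\<beta>' (\<phi> t))) * h) \<circ> (\<lambda>h. norm (\<beta>' (\<phi> t)) * h) = id"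
        using regular[OF \<phi>mem(1)[OF t]] by (auto simp: fun_eq_iff)
    qed (use \<phi>mem \<phi>len t in \<open>auto intro: linear_times\<close>)
    then show ?thesis
      using \<phi>mem(2)[OF t] by (simp add: img has_vector_derivative_def mult.commute)
  qed
  define \<tau>' where
    "\<tau>' s = (\<beta>'' s - (sgn (\<beta>' s) \<bullet> \<beta>'' s) *\<^sub>R sgn (\<beta>' s)) /\<^sub>R norm (\<beta>' s)" for s
  have \<tau>: "((\<lambda>s. sgn (\<beta>' s)) has_vector_derivative \<tau>' s) (at s within {0..e})" if "s \<in> {0..e}" for s
  proof -
    have "(\<beta>' has_derivative (\<lambda>h. h *\<^sub>R \<beta>'' s)) (at s within {0..e})"
      using \<beta>'[OF that] by (simp add: has_vector_derivative_def)
    from has_derivative_sgn[OF this regular[OF that]] show ?thesis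
      unfolding has_vector_derivative_def \<tau>'_def
      by (rule has_derivative_eq_rhs) (simp add: fun_eq_iff algebra_simps)
  qed
  have c\<tau>': "continuous_on {0..e} \<tau>'"
    unfolding \<tau>'_def[abs_def] using regular by (intro continuous_intros c\<beta>' \<beta>'') auto
  have chain: "((\<lambda>t. f (\<phi> t)) has_vector_derivative inverse (norm (\<beta>' (\<phi> t))) *\<^sub>R f') (at t within {0..l})"
    if "t \<in> {0..l}" "(f has_vector_derivative f') (at (\<phi> t) within {0..e})" for f :: "real \<Rightarrow> 'a" and f' t
  proof -
    have "\<phi> ` {0..l} \<subseteq> {0..e}"
      using \<phi>mem by auto
    then have "(f has_derivative (\<lambda>h. h *\<^sub>R f')) (at (\<phi> t) within \<phi> ` {0..l})"
      using that(2) has_derivative_subset unfolding has_vector_derivative_def by blast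
    from vector_derivative_diff_chain_within[OF \<phi>[OF that(1)] this] show ?thesis
      by (simp add: o_def)
  qed
  define \<gamma> where "\<gamma> t = \<beta> (\<phi> t)" for t
  have 1: "(\<gamma> has_vector_derivative sgn (\<beta>' (\<phi> t))) (at t within {0..l})" if "t \<in> {0..l}" for t
    using chain[OF that \<beta>[OF \<phi>mem(1)[OF that]]] by (simp add: \<gamma>_def[abs_def] sgn_div_norm)
  have 2: "((\<lambda>t. sgn (\<beta>' (\<phi> t))) has_vector_derivative inverse (norm (\<beta>' (\<phi> t))) *\<^sub>R \<tau>' (\<phi> t)) (at t within {0..l})"
    if "t \<in> {0..l}" for t
    using chain[OF that \<tau>[OF \<phi>mem(1)[OF that]]] .
  have "continuous_on {0..l} (\<lambda>t. \<beta>' (\<phi> t))" "continuous_on {0..l} (\<lambda>t. \<tau>' (\<phi> t))"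
    using \<phi>mem
    by (auto intro!: continuous_on_compose2[OF c\<beta>' c\<phi>] continuous_on_compose2[OF c\<tau>' c\<phi>])
  then have 3: "continuous_on {0..l} (\<lambda>t. inverse (norm (\<beta>' (\<phi> t))) *\<^sub>R \<tau>' (\<phi> t))"
    using regular \<phi>mem by (intro continuous_intros) auto
  have v: "velocity {0..l} \<gamma> t = sgn (\<beta>' (\<phi> t))" if "t \<in> {0..l}" for t
    using velocity_eq[OF l that 1[OF that]] .
  have "\<phi> 0 = 0"
    using \<phi>len[of 0] e len0 by simp
  show thesis
  proof
    show "C2_curve_on {0..l} \<gamma>"
      by (rule C2_curve_onI[OF l 1 2 3])
    show "\<gamma> ` {0..l} \<subseteq> \<beta> ` {0..e}"
      using \<phi>mem by (auto simp: \<gamma>_def)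
    show "norm (velocity {0..l} \<gamma> t) = 1" if "t \<in> {0..l}" for t
      using v[OF that] regular[OF \<phi>mem(1)[OF that]] by (simp add: norm_sgn)
    show "velocity {0..l} \<gamma> 0 = sgn (\<beta>' 0)"
      using v[of 0] l \<open>\<phi> 0 = 0\<close> by simp
  qed (use l \<open>\<phi> 0 = 0\<close> in \<open>auto simp: \<gamma>_def\<close>)
qed

lemma (in surface_chart) unit_speed_curve_in_direction:
  assumes p: "p \<in> W" and v: "v \<in> range (X' (Y p))" "norm v = 1"
  obtains l \<gamma> where "unit_speed_curve S l \<gamma>" "\<gamma> 0 = p" "velocity {0..l} \<gamma> 0 = v"
proof -
  obtain h where h: "v = X' (Y p) h"
    using v by blast
  have "h \<noteq> 0"
    using h v by auto
  obtain e where e: "e > 0" "\<And>s. \<bar>s\<bar> \<le> e \<Longrightarrow> Y p + s *\<^sub>R h \<in> U"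
    using line_in_U[OF Y_in_U[OF p]] by metis
  have mem: "Y p + s *\<^sub>R h \<in> U" if "s \<in> {0..e}" for s
    using e(2)[of s] that by auto
  have reg: "X' (Y p + s *\<^sub>R h) h \<noteq> 0" if "s \<in> {0..e}" for s
    using L_X'[OF mem[OF that], of h] linear_0[OF linear_L] \<open>h \<noteq> 0\<close> by metis
  obtain l \<gamma> where *: "0 < l" "C2_curve_on {0..l} \<gamma>"
    "\<gamma> ` {0..l} \<subseteq> (\<lambda>s. X (Y p + s *\<^sub>R h)) ` {0..e}" "\<gamma> 0 = X (Y p + 0 *\<^sub>R h)"
    "\<And>t. t \<in> {0..l} \<Longrightarrow> norm (velocity {0..l} \<gamma> t) = 1"
    "velocity {0..l} \<gamma> 0 = sgn (X' (Y p + 0 *\<^sub>R h) h)"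
    using unit_speed_reparametrization[OF e(1) X_line[OF mem] X''_line_continuous[OF mem] reg] by blast
  have "(\<lambda>s. X (Y p + s *\<^sub>R h)) ` {0..e} \<subseteq> S"
    using mem homeo W by (force simp: homeomorphism_def openin_open)
  then have "unit_speed_curve S l \<gamma>"
    using * by (auto simp: unit_speed_curve_def)
  moreover have "velocity {0..l} \<gamma> 0 = v"
    using * h v by (simp add: sgn_div_norm)
  ultimately show thesis
    using that * X_Y[OF p] by simp
qed

lemma unit_speed_curve_exists:
  assumes "C2_surface S" and "unit_normal_field S N" and "p \<in> S" and "v \<bullet> N p = 0" "norm v = 1"
  obtains l \<gamma> where "unit_speed_curve S l \<gamma>" "\<gamma> 0 = p" "velocity {0..l} \<gamma> 0 = v"
proof -
  obtain W U X Y X' X'' where c: "surface_chart S W U X Y X' X''" "p \<in> W"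
    using surface_chart_exists assms by blast
  have "v \<in> range (X' (Y p))"
    using surface_chart.tangent_space_eq_perp[OF c(1) _ c(2)] surface_chart.tangent_space_eq_range[OF c]
      assms by auto
  then show thesis
    using surface_chart.unit_speed_curve_in_direction[OF c _ assms(5)] that by blast
qed

section \<open>Spheres and rigid motions\<close>

text \<open>A curve on the sphere has a constant distance from the center, which makes its velocity
  orthogonal to the radius; conversely, great circles have all these velocities.\<close>

lemma tangent_space_sphere:
  assumes \<rho>: "0 < \<rho>" and q: "q \<in> sphere c \<rho>"
  shows "tangent_space (sphere c \<rho>) q = {v. v \<bullet> (q - c) = 0}"
proof
  show "tangent_space (sphere c \<rho>) q \<subseteq> {v. v \<bullet> (q - c) = 0}"
  proof
    fix v assume "v \<in> tangent_space (sphere c \<rho>) q"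
    then obtain e \<alpha> where *: "e > 0" "C2_curve_on {-e..e} \<alpha>" "\<alpha> ` {-e..e} \<subseteq> sphere c \<rho>" "\<alpha> 0 = q"
      "velocity {-e..e} \<alpha> 0 = v"
      unfolding tangent_space_def by blast
    have "(\<alpha> has_vector_derivative v) (at 0 within {-e..e})"
      using has_velocity[of "{-e..e}" \<alpha> 0] * by (auto simp: C2_curve_on_def)
    then have \<alpha>: "(\<alpha> has_vector_derivative v) (at 0)"
      using * by (simp add: at_within_Icc_at)
    then have "((\<lambda>t. (\<alpha> t - c) \<bullet> (\<alpha> t - c)) has_derivative (\<lambda>t. 2 * t * (v \<bullet> (q - c)))) (at 0)"
      unfolding has_vector_derivative_def using *
      by (auto intro!: derivative_eq_intros simp: inner_commute)
    moreover have "((\<lambda>t. (\<alpha> t - c) \<bullet> (\<alpha> t - c)) has_derivative (\<lambda>t. 0)) (at 0)"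
    proof (rule has_derivative_transform_within_open[OF has_derivative_const, where s = "{-e<..<e}"])
      show "\<rho>\<^sup>2 = (\<alpha> t - c) \<bullet> (\<alpha> t - c)" if "t \<in> {-e<..<e}" for t
      proof -
        have "\<alpha> t \<in> sphere c \<rho>"
          using *(3) that by (auto simp: image_subset_iff)
        then show ?thesis
          by (simp add: dot_square_norm dist_norm norm_minus_commute)
      qed
    qed (use * in auto)
    ultimately have "(\<lambda>t. 2 * t * (v \<bullet> (q - c))) = (\<lambda>t. 0)"
      using has_derivative_unique by blast
    from fun_cong[OF this, of 1] show "v \<in> {v. v \<bullet> (q - c) = 0}"
      by simp
  qed
  show "{v. v \<bullet> (q - c) = 0} \<subseteq> tangent_space (sphere c \<rho>) q"
  proof
    fix v assume "v \<in> {v. v \<bullet> (q - c) = 0}"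
    then have perp: "v \<bullet> (q - c) = 0"
      by simp
    have nq: "norm (q - c) = \<rho>"
      using q by (simp add: dist_norm norm_minus_commute)
    \<comment> \<open>The great circle through \<open>q\<close> in the direction of \<open>v\<close>, traversed at angular speed \<open>k\<close>; for
      \<open>v = 0\<close> it degenerates to a point, with \<open>k = 0\<close> and \<open>d = 0\<close>.\<close>
    define k where "k = norm v / \<rho>"
    define d where "d = v /\<^sub>R k"
    have kd: "k *\<^sub>R d = v"
      using \<rho> by (cases "v = 0") (auto simp: d_def k_def)
    define \<alpha> where "\<alpha> s = c + cos (k * s) *\<^sub>R (q - c) + sin (k * s) *\<^sub>R d" for s
    define \<alpha>' where "\<alpha>' s = - (k * sin (k * s)) *\<^sub>R (q - c) + (k * cos (k * s)) *\<^sub>R d" for s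
    define \<alpha>'' where "\<alpha>'' s = - (k * k * cos (k * s)) *\<^sub>R (q - c) - (k * k * sin (k * s)) *\<^sub>R d" for s
    have 1: "(\<alpha> has_vector_derivative \<alpha>' s) (at s within {-1..1})" for s
      unfolding \<alpha>_def[abs_def] \<alpha>'_def
      by (auto intro!: derivative_eq_intros simp: algebra_simps)
    have 2: "(\<alpha>' has_vector_derivative \<alpha>'' s) (at s within {-1..1})" for s
      unfolding \<alpha>'_def[abs_def] \<alpha>''_def
      by (auto intro!: derivative_eq_intros simp: algebra_simps)
    have 3: "continuous_on {-1..1} \<alpha>''"
      unfolding \<alpha>''_def[abs_def] by (intro continuous_intros)
    have "\<alpha> s \<in> sphere c \<rho>" for s
    proof (cases "v = 0")
      case True
      then show ?thesis
        using q by (simp add: \<alpha>_def k_def d_def dist_norm)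
    next
      case False
      then have k: "k \<noteq> 0"
        using \<rho> by (simp add: k_def)
      have "d \<bullet> d = \<rho>\<^sup>2" "(q - c) \<bullet> (q - c) = \<rho>\<^sup>2"
        using False \<rho> nq by (simp_all add: dot_square_norm d_def k_def)
      moreover have "(q - c) \<bullet> d = 0"
        using perp by (simp add: d_def inner_commute)
      ultimately have "(\<alpha> s - c) \<bullet> (\<alpha> s - c) = (cos (k * s))\<^sup>2 * \<rho>\<^sup>2 + (sin (k * s))\<^sup>2 * \<rho>\<^sup>2"
        by (simp add: \<alpha>_def inner_add_left inner_add_right inner_commute power2_eq_square)
      also have "\<dots> = \<rho>\<^sup>2"
        by (simp flip: distrib_right)
      finally have "norm (\<alpha> s - c) = \<rho>"
        using \<rho> by (simp add: norm_eq_sqrt_inner)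
      then show ?thesis
        by (simp add: dist_norm norm_minus_commute)
    qed
    moreover have "C2_curve_on {-1..1} \<alpha>"
      by (rule C2_curve_onI[OF _ 1 2 3]) auto
    moreover have "velocity {-1..1} \<alpha> 0 = v"
      using velocity_eq[OF _ _ 1[of 0]] kd by (simp add: \<alpha>'_def)
    moreover have "\<alpha> 0 = q"
      by (simp add: \<alpha>_def)
    ultimately show "v \<in> tangent_space (sphere c \<rho>) q"
      unfolding tangent_space_def
      by (intro CollectI exI[of _ 1] conjI exI[of _ \<alpha>]) auto
  qed
qed

lemma rotation_matrix_norm:
  fixes A :: "real^'n^'n"
  assumes "rotation_matrix A"
  shows "norm (A *v x) = norm x"
proof -
  have "orthogonal_transformation ((*v) A)"
    using assms unfolding rotation_matrix_def orthogonal_transformation_matrix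
    by (simp add: matrix_vector_mul_linear)
  then show ?thesis
    by (simp add: orthogonal_transformation)
qed

lemma rotation_matrix_surj:
  fixes A :: "real^'n^'n"
  assumes "rotation_matrix A"
  shows "A *v (transpose A *v x) = x"
  using assms by (simp add: rotation_matrix_def orthogonal_matrix_def matrix_vector_mul_assoc del: transpose_matrix_vector)

lemma rigid_image_sphere:
  assumes A: "rotation_matrix (A t)"
  shows "rigid A b t ` sphere c \<rho> = sphere (rigid A b t c) \<rho>"
proof -
  have d: "dist (rigid A b t c) (rigid A b t x) = dist c x" for x
    using rotation_matrix_norm[OF A, of "c - x"]
    by (simp add: rigid_def dist_norm matrix_vector_mult_diff_distrib)
  have s: "rigid A b t (transpose (A t) *v (y - b t)) = y" for y
    by (simp add: rigid_def rotation_matrix_surj[OF A] del: transpose_matrix_vector)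
  show ?thesis
  proof
    show "rigid A b t ` sphere c \<rho> \<subseteq> sphere (rigid A b t c) \<rho>"
      using d by auto
    show "sphere (rigid A b t c) \<rho> \<subseteq> rigid A b t ` sphere c \<rho>"
    proof
      fix y assume "y \<in> sphere (rigid A b t c) \<rho>"
      then have "transpose (A t) *v (y - b t) \<in> sphere c \<rho>"
        using d[of "transpose (A t) *v (y - b t)"] s[of y] by simp
      then show "y \<in> rigid A b t ` sphere c \<rho>"
        using s[of y] by (metis imageI)
    qed
  qed
qed

lemma continuous_fixed_abs_constant:
  fixes f :: "real \<Rightarrow> real"
  assumes "continuous_on {0..l} f" and "\<And>t. t \<in> {0..l} \<Longrightarrow> \<bar>f t\<bar> = \<bar>r\<bar>" and "f 0 = r"
    and "t \<in> {0..l}"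
  shows "f t = r"
proof -
  have "f ` {0..l} \<subseteq> {r, - r}"
    using assms(2) by force
  then have "finite (f ` {0..l})"
    using finite_subset by blast
  then have "f constant_on {0..l}"
    using continuous_finite_range_constant assms(1) connected_Icc by blast
  moreover have "0 \<in> {0..l}"
    using assms(4) by auto
  ultimately show ?thesis
    using assms(3,4) unfolding constant_on_def by metis
qed

section \<open>The center of a rolling sphere\<close>

text \<open>The tangent plane of a sphere determines the line on which the center lies, so tangency leaves two
  points on the normal line of \<open>S\<close> for the center, one on each side of \<open>S\<close>. The side cannot change
  along a continuous motion.\<close>

lemma rolling_center:
  assumes S: "C2_surface S" and N: "unit_normal_field S N" and r: "r \<noteq> 0"
    and \<gamma>: "continuous_on {0..l} \<gamma>" "\<gamma> 0 = p"
    and motion: "motion (rolling_sphere N p r) S \<gamma> l A b"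
    and t: "t \<in> {0..l}"
  shows "rigid A b t (ball_center N p r) = \<gamma> t + r *\<^sub>R N (\<gamma> t)"
proof -
  define d where "d t = rigid A b t (ball_center N p r) - \<gamma> t" for t
  have \<gamma>S: "\<gamma> t \<in> S" if "t \<in> {0..l}" for t
    using motion that by (auto simp: motion_def tangent_at_def)
  have unit: "N (\<gamma> t) \<bullet> N (\<gamma> t) = 1" if "t \<in> {0..l}" for t
    using N \<gamma>S[OF that] by (simp add: unit_normal_field_def dot_square_norm)
  have *: "d t = (d t \<bullet> N (\<gamma> t)) *\<^sub>R N (\<gamma> t)" "\<bar>d t \<bullet> N (\<gamma> t)\<bar> = \<bar>r\<bar>" if t: "t \<in> {0..l}" for t
  proof -
    let ?c = "rigid A b t (ball_center N p r)"
    have "tangent_at (sphere ?c \<bar>r\<bar>) S (\<gamma> t)"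
      using motion t rigid_image_sphere[of A t b "ball_center N p r" "\<bar>r\<bar>"]
      unfolding motion_def rolling_sphere_def by metis
    then have mem: "\<gamma> t \<in> sphere ?c \<bar>r\<bar>"
      and "tangent_space (sphere ?c \<bar>r\<bar>) (\<gamma> t) = tangent_space S (\<gamma> t)"
      by (auto simp: tangent_at_def)
    then have perp: "v \<bullet> (\<gamma> t - ?c) = 0 \<longleftrightarrow> v \<bullet> N (\<gamma> t) = 0" for v
      using tangent_space_sphere[OF _ mem] tangent_space_perp_normal[OF S N \<gamma>S[OF t]] r by auto
    \<comment> \<open>The component of \<open>d t\<close> orthogonal to the normal is tangent to \<open>S\<close>, hence to the sphere, whose radius
      at the point of contact is \<open>- d t\<close>; so this component is orthogonal to itself.\<close>
    let ?w = "d t - (d t \<bullet> N (\<gamma> t)) *\<^sub>R N (\<gamma> t)"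
    have wN: "?w \<bullet> N (\<gamma> t) = 0"
      by (simp add: inner_diff_left unit[OF t])
    then have "?w \<bullet> d t = 0"
      using perp[of ?w] by (simp add: d_def inner_diff_right)
    then have "?w \<bullet> ?w = 0"
      using wN by (simp add: inner_diff_right)
    then show 1: "d t = (d t \<bullet> N (\<gamma> t)) *\<^sub>R N (\<gamma> t)"
      by simp
    have "norm (d t) = \<bar>r\<bar>"
      using mem by (simp add: d_def dist_norm)
    moreover have "norm ((d t \<bullet> N (\<gamma> t)) *\<^sub>R N (\<gamma> t)) = \<bar>d t \<bullet> N (\<gamma> t)\<bar>"
      using unit[OF t] by (simp add: norm_eq_1[symmetric])
    ultimately show "\<bar>d t \<bullet> N (\<gamma> t)\<bar> = \<bar>r\<bar>"
      using 1 by simp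
  qed
  \<comment> \<open>The signed distance \<open>d \<bullet> N\<close> of the center is continuous and starts at \<open>r\<close>.\<close>
  have "continuous_on {0..l} (\<lambda>t. N (\<gamma> t))"
    using N \<gamma>S by (intro continuous_on_compose2[OF _ \<gamma>(1)]) (auto simp: unit_normal_field_def)
  moreover have "continuous_on {0..l} A" "continuous_on {0..l} b"
    using motion by (auto simp: motion_def C1_curve_on_def differentiable_imp_continuous_on)
  then have "continuous_on {0..l} (\<lambda>t. A t *v ball_center N p r)"
    using linear_continuous_on_compose[of "{0..l}" A "\<lambda>M. M *v ball_center N p r"]
    by (simp add: linear_iff matrix_vector_mult_add_rdistrib scaleR_matrix_vector_assoc)
  then have "continuous_on {0..l} d"
    unfolding d_def[abs_def] rigid_def
    by (intro continuous_intros \<gamma> \<open>continuous_on {0..l} b\<close>)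
  ultimately have "continuous_on {0..l} (\<lambda>t. d t \<bullet> N (\<gamma> t))"
    by (intro continuous_intros)
  moreover have "d 0 \<bullet> N (\<gamma> 0) = r"
  proof -
    have "d 0 = r *\<^sub>R N (\<gamma> 0)"
      using motion \<gamma> by (simp add: d_def motion_def ball_center_def)
    then show ?thesis
      using unit[of 0] t by simp
  qed
  ultimately have "d t \<bullet> N (\<gamma> t) = r"
    using continuous_fixed_abs_constant[of l "\<lambda>t. d t \<bullet> N (\<gamma> t)" r t] * t by blast
  then show ?thesis
    using *(1)[OF t] by (simp add: d_def algebra_simps)
qed

text \<open>The initial speed is the speed of the curve that \<open>rolling_center\<close> assigns to the center, hence a
  property of the surface and of the initial direction.\<close>

lemma initial_speed:
  assumes S: "C2_surface S" and N: "unit_normal_field S N" and r: "r \<noteq> 0"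
    and D: "(N has_derivative D) (at p within S)"
    and \<gamma>: "unit_speed_curve S l \<gamma>" "\<gamma> 0 = p"
    and rolls: "rolls_with_initial_speed S N p r \<gamma> l \<sigma>"
  shows "\<sigma> = norm (velocity {0..l} \<gamma> 0 + r *\<^sub>R D (velocity {0..l} \<gamma> 0))"
proof -
  let ?v = "velocity {0..l} \<gamma> 0"
  obtain \<epsilon> A b where \<epsilon>: "0 < \<epsilon>" "\<epsilon> \<le> l" and roll: "rolling (rolling_sphere N p r) S \<gamma> \<epsilon> A b"
    and \<sigma>: "speed \<epsilon> A b (ball_center N p r) 0 = \<sigma>"
    using rolls unfolding rolls_with_initial_speed_def by blast
  have "C1_curve_on {0..l} \<gamma>"
    using \<gamma> by (simp add: unit_speed_curve_def C2_curve_on_def)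
  from has_velocity[OF this, of 0] have v: "(\<gamma> has_vector_derivative ?v) (at 0 within {0..\<epsilon>})"
    using \<epsilon> has_vector_derivative_within_subset[of \<gamma> ?v 0 "{0..l}" "{0..\<epsilon>}"] by simp
  have "continuous_on {0..l} \<gamma>"
    using \<open>C1_curve_on {0..l} \<gamma>\<close> by (simp add: C1_curve_on_def differentiable_imp_continuous_on)
  then have c: "continuous_on {0..\<epsilon>} \<gamma>"
    using \<epsilon> continuous_on_subset by force
  have "(N has_derivative D) (at (\<gamma> 0) within \<gamma> ` {0..\<epsilon>})"
  proof (rule has_derivative_subset)
    show "(N has_derivative D) (at (\<gamma> 0) within S)"
      using D \<gamma> by simp
  qed (use \<gamma> \<epsilon> in \<open>auto simp: unit_speed_curve_def\<close>)
  from vector_derivative_diff_chain_within[OF v this]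
  have Nv: "((\<lambda>s. N (\<gamma> s)) has_vector_derivative D ?v) (at 0 within {0..\<epsilon>})"
    by (simp add: o_def)
  have center: "rigid A b s (ball_center N p r) = \<gamma> s + r *\<^sub>R N (\<gamma> s)" if "s \<in> {0..\<epsilon>}" for s
    using rolling_center[OF S N r c \<gamma>(2) _ that] roll by (simp add: rolling_def rotational_motion_def)
  have "((\<lambda>s. rigid A b s (ball_center N p r)) has_vector_derivative ?v + r *\<^sub>R D ?v) (at 0 within {0..\<epsilon>})"
  proof (rule has_vector_derivative_transform)
    show "((\<lambda>s. \<gamma> s + r *\<^sub>R N (\<gamma> s)) has_vector_derivative ?v + r *\<^sub>R D ?v) (at 0 within {0..\<epsilon>})"
      by (rule derivative_eq_intros v Nv refl)+ simp
  qed (use \<epsilon> center in auto)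
  from velocity_eq[OF \<epsilon>(1) _ this] show ?thesis
    using \<sigma> \<epsilon> by (simp add: speed_def)
qed

section \<open>Existence of rollings\<close>

lemma short_initial_interval:
  fixes f :: "real \<Rightarrow> 'a::topological_space"
  assumes "0 < l" and f: "continuous_on {0..l} f" and T: "open T" "f 0 \<in> T"
  obtains \<epsilon> where "0 < \<epsilon>" "\<epsilon> \<le> l" "f ` {0..\<epsilon>} \<subseteq> T"
proof -
  have "0 \<in> {0..l}"
    using \<open>0 < l\<close> by simp
  with f T obtain A where A: "open A" "0 \<in> A" "\<forall>y\<in>{0..l}. y \<in> A \<longrightarrow> f y \<in> T"
    unfolding continuous_on_topological by metis
  obtain d where d: "d > 0" "ball 0 d \<subseteq> A"
    using A openE by blast
  show thesis
  proof (rule that[of "min l (d / 2)"])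
    show "f ` {0..min l (d / 2)} \<subseteq> T"
    proof (rule image_subsetI)
      fix x assume "x \<in> {0..min l (d / 2)}"
      then have "x \<in> ball 0 d" "x \<in> {0..l}"
        using d by (auto simp: dist_real_def)
      then show "f x \<in> T"
        using A d by blast
    qed
  qed (use \<open>0 < l\<close> d in auto)
qed

definition cross_matrix :: "real^3 \<Rightarrow> real^3^3" where
  "cross_matrix \<omega> = matrix (cross3 \<omega>)"

lemma cross_matrix_mult: "cross_matrix \<omega> *v x = cross3 \<omega> x"
proof -
  have "linear (cross3 \<omega>)"
    using bilinear_cross by (simp add: bilinear_def)
  then show ?thesis
    unfolding cross_matrix_def by (simp add: matrix_vector_mul)
qed

lemma continuous_on_cross_matrix:
  fixes I :: "real set"
  assumes "continuous_on I \<omega>"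
  shows "continuous_on I (\<lambda>t. cross_matrix (\<omega> t))"
  unfolding cross_matrix_def matrix_def
  by (intro continuous_on_vec_lambda continuous_on_component continuous_on_cross assms continuous_on_const)

lemma bounded_bilinear_matrix_matrix_mult:
  "bounded_bilinear ((**) :: real^'n^'m \<Rightarrow> real^'k^'n \<Rightarrow> real^'k^'m)"
  unfolding bilinear_conv_bounded_bilinear[symmetric] bilinear_def linear_iff
  by (auto simp: vec_eq_iff matrix_matrix_mult_def sum_distrib_left sum.distrib algebra_simps)

lemma bounded_bilinear_matrix_vector_mult:
  "bounded_bilinear ((*v) :: real^'n^'m \<Rightarrow> real^'n \<Rightarrow> real^'m)"
  unfolding bilinear_conv_bounded_bilinear[symmetric] bilinear_def linear_iff
  by (auto simp: vec_eq_iff matrix_vector_mult_def sum_distrib_left sum.distrib algebra_simps)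

lemma has_vector_derivative_matrix_vector_mult:
  assumes "(A has_vector_derivative A') (at t within I)"
  shows "((\<lambda>t. (A t :: real^'n^'m) *v x) has_vector_derivative A' *v x) (at t within I)"
  using bounded_linear.has_vector_derivative[OF
      bounded_bilinear.bounded_linear_left[OF bounded_bilinear_matrix_vector_mult] assms] .

text \<open>The solution of the linear equation with skew-symmetric coefficients preserves inner products, and
  its determinant, then 1 or -1, cannot leave the value 1 continuously. The interval may have to be shortened
  to make the Picard operator a contraction.\<close>

lemma rotation_with_angular_velocity:
  assumes e: "0 < e" and \<omega>: "continuous_on {0..e} \<omega>"
  obtains \<epsilon> A where "0 < \<epsilon>" "\<epsilon> \<le> e" "A 0 = mat 1"
    "\<And>t. t \<in> {0..\<epsilon>} \<Longrightarrow> rotation_matrix (A t)"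
    "\<And>t. t \<in> {0..\<epsilon>} \<Longrightarrow>
       (A has_vector_derivative cross_matrix (\<omega> t) ** A t) (at t within {0..\<epsilon>})"
proof -
  define Q where "Q t = cross_matrix (\<omega> t)" for t
  have Q: "continuous_on {0..e} Q"
    unfolding Q_def[abs_def] by (rule continuous_on_cross_matrix[OF \<omega>])
  then have "bounded (Q ` {0..e})"
    using compact_continuous_image compact_imp_bounded compact_Icc by blast
  then obtain M where M: "\<And>t. t \<in> {0..e} \<Longrightarrow> norm (Q t) \<le> M"
    unfolding bounded_iff by blast
  have M0: "0 \<le> M"
    using order_trans[OF norm_ge_zero M[of 0]] e by simp
  obtain B where B: "0 < B" "\<And>(P :: real^3^3) (R :: real^3^3). norm (P ** R) \<le> norm P * norm R * B"
    using bounded_bilinear.pos_bounded[OF bounded_bilinear_matrix_matrix_mult[where 'n=3 and 'm=3 and 'k=3]]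
    by blast
  define K where "K = M * B"
  have K: "0 \<le> K"
    using M0 B by (simp add: K_def)
  \<comment> \<open>Any length below \<open>1 / K\<close> makes the Picard operator a contraction; \<open>K = 0\<close> is possible.\<close>
  define \<epsilon> where "\<epsilon> = min e (1 / (K + 2))"
  have \<epsilon>: "0 < \<epsilon>" "\<epsilon> \<le> e"
    using e K by (auto simp: \<epsilon>_def)
  have "\<epsilon> * K \<le> 1 / (K + 2) * K"
    using K by (intro mult_right_mono) (auto simp: \<epsilon>_def)
  also have "\<dots> < 1"
    using K by (simp add: divide_simps)
  finally have small: "\<epsilon> * K < 1" .
  have Q\<epsilon>: "continuous_on {0..\<epsilon>} Q"
    using Q \<epsilon> continuous_on_subset by force
  have cont: "continuous_on {0..\<epsilon>} (\<lambda>t. Q t ** x t)" if "continuous_on {0..\<epsilon>} x" for x :: "real \<Rightarrow> real^3^3"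
    using bounded_bilinear.continuous_on[OF bounded_bilinear_matrix_matrix_mult Q\<epsilon> that] .
  have lip: "norm (Q t ** x - Q t ** y) \<le> K * norm (x - y)" if "t \<in> {0..\<epsilon>}" for t and x y :: "real^3^3"
  proof -
    have "norm (Q t ** x - Q t ** y) = norm (Q t ** (x - y))"
      by (simp add: bounded_bilinear.diff_right[OF bounded_bilinear_matrix_matrix_mult])
    also have "\<dots> \<le> norm (Q t) * norm (x - y) * B"
      by (rule B)
    also have "\<dots> \<le> M * norm (x - y) * B"
      using M[of t] that \<epsilon> B by (intro mult_right_mono) auto
    finally show ?thesis
      by (simp add: K_def mult_ac)
  qed
  obtain A where A0: "A 0 = mat 1"
    and A: "\<And>t. t \<in> {0..\<epsilon>} \<Longrightarrow> (A has_vector_derivative Q t ** A t) (at t within {0..\<epsilon>})"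
    using Lipschitz_ode_local_solution[of \<epsilon> "\<lambda>t x. Q t ** x" K "mat 1", OF \<epsilon>(1) cont lip K small] by blast
  have inner: "(A t *v x) \<bullet> (A t *v y) = x \<bullet> y" if t: "t \<in> {0..\<epsilon>}" for t x y
  proof -
    have "((\<lambda>t. (A t *v x) \<bullet> (A t *v y)) has_derivative (\<lambda>h. 0)) (at s within {0..\<epsilon>})" if s: "s \<in> {0..\<epsilon>}" for s
    proof -
      have d: "((\<lambda>t. A t *v z) has_derivative (\<lambda>h. h *\<^sub>R cross3 (\<omega> s) (A s *v z))) (at s within {0..\<epsilon>})" for z
        using has_vector_derivative_matrix_vector_mult[OF A[OF s], of z]
        by (simp add: has_vector_derivative_def Q_def cross_matrix_mult flip: matrix_vector_mul_assoc)
      have "cross3 w a \<bullet> b + a \<bullet> cross3 w b = 0" for w a b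
        by (simp add: cross3_simps)
      then have "(A s *v x) \<bullet> (h *\<^sub>R cross3 (\<omega> s) (A s *v y)) + (h *\<^sub>R cross3 (\<omega> s) (A s *v x)) \<bullet> (A s *v y) = 0" for h
        by (simp add: inner_commute flip: distrib_left)
      then show ?thesis
        using has_derivative_inner[OF d d, of x y] by simp
    qed
    from has_derivative_zero_constant[OF convex_real_interval(5) this]
    obtain k where "\<forall>s\<in>{0..\<epsilon>}. (A s *v x) \<bullet> (A s *v y) = k"
      by blast
    then have "(A t *v x) \<bullet> (A t *v y) = (A 0 *v x) \<bullet> (A 0 *v y)"
      using t by simp
    then show ?thesis
      using A0 by simp
  qed
  have orth: "orthogonal_matrix (A t)" if "t \<in> {0..\<epsilon>}" for t
  proof -
    have "orthogonal_transformation ((*v) (A t))"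
      using inner[OF that] by (simp add: orthogonal_transformation_def matrix_vector_mul_linear)
    then show ?thesis
      by (simp add: orthogonal_transformation_matrix)
  qed
  have cA: "continuous_on {0..\<epsilon>} A"
    using A has_vector_derivative_continuous continuous_on_eq_continuous_within by blast
  have "continuous_on {0..\<epsilon>} (\<lambda>t. det (A t))"
    unfolding det_3 by (intro continuous_intros cA)
  moreover have "\<bar>det (A t)\<bar> = \<bar>1\<bar>" if "t \<in> {0..\<epsilon>}" for t
    using det_orthogonal_matrix[OF orth[OF that]] by auto
  moreover have "det (A 0) = 1"
    using A0 by simp
  ultimately have "det (A t) = 1" if "t \<in> {0..\<epsilon>}" for t
    using continuous_fixed_abs_constant[of \<epsilon> "\<lambda>t. det (A t)" 1 t] that by blast
  then have "rotation_matrix (A t)" if "t \<in> {0..\<epsilon>}" for t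
    using orth that by (simp add: rotation_matrix_def)
  then show thesis
    using that[of \<epsilon> A] \<epsilon> A0 A by (simp add: Q_def)
qed

lemma angular_velocity_eq:
  assumes "rotational_part l A t = cross_matrix \<omega>"
  shows "angular_velocity l A t = \<omega>"
  unfolding angular_velocity_def assms cross_matrix_mult
proof (rule the_equality)
  fix w assume *: "\<forall>x. cross3 \<omega> x = cross3 w x"
  show "w = \<omega>"
    using spec[OF *, of "axis 1 1"] spec[OF *, of "axis 2 1"]
    by (simp add: cross3_simps axis_def forall_3)
qed simp

lemma cross3_cross3_same: "cross3 (cross3 m c) m = (m \<bullet> m) *\<^sub>R c - (m \<bullet> c) *\<^sub>R m"
  by (simp add: cross3_simps forall_3)

text \<open>Rolling prescribes the angular velocity. The velocity \<open>c'\<close> of the center is tangent to \<open>S\<close> and must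
  equal \<open>\<omega> \<times> r m\<close>, where \<open>m\<close> is the unit normal along the curve; for tangent \<open>\<omega>\<close> this means
  \<open>\<omega> = (m \<times> c') / r\<close>. The rotations \<open>A\<close> are then found by integration and the translations follow
  from the position of the center. The only obstruction is that the motion has to be rotational,
  which is guaranteed on a short interval if \<open>c'\<close> does not vanish at the start.\<close>

lemma rolling_exists:
  assumes S: "C2_surface S" and N: "unit_normal_field S N" and r: "r \<noteq> 0"
    and V: "openin (top_of_set S) V" "p \<in> V"
    and DN: "\<And>q. q \<in> V \<Longrightarrow> (N has_derivative blinfun_apply (D q)) (at q within S)"
    and D: "continuous_on V D"
    and D_perp: "\<And>q w. q \<in> V \<Longrightarrow> D q w \<bullet> N q = 0"
    and \<gamma>: "unit_speed_curve S l \<gamma>" "\<gamma> 0 = p" "velocity {0..l} \<gamma> 0 = v"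
    and ne: "v + r *\<^sub>R D p v \<noteq> 0"
  shows "rolls_with_initial_speed S N p r \<gamma> l (norm (v + r *\<^sub>R D p v))"
proof -
  have l: "0 < l" and C2: "C2_curve_on {0..l} \<gamma>" and \<gamma>S: "\<gamma> ` {0..l} \<subseteq> S"
    using \<gamma> by (auto simp: unit_speed_curve_def)
  define g' where "g' = velocity {0..l} \<gamma>"
  have g': "(\<gamma> has_vector_derivative g' t) (at t within {0..l})" if "t \<in> {0..l}" for t
    using has_velocity[OF _ that] C2 by (auto simp: g'_def C2_curve_on_def)
  have c\<gamma>: "continuous_on {0..l} \<gamma>" and cg': "continuous_on {0..l} g'"
    using C2 by (auto simp: C2_curve_on_def C1_curve_on_def g'_def differentiable_imp_continuous_on)
  obtain T where T: "open T" "V = S \<inter> T"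
    using V by (auto simp: openin_open)
  obtain \<epsilon>1 where \<epsilon>1: "0 < \<epsilon>1" "\<epsilon>1 \<le> l" "\<gamma> ` {0..\<epsilon>1} \<subseteq> T"
    using short_initial_interval[OF l c\<gamma> T(1)] V T \<gamma> by auto
  have \<gamma>V: "\<gamma> t \<in> V" if "t \<in> {0..\<epsilon>1}" for t
    using \<epsilon>1 \<gamma>S that T by auto
  define m where "m t = N (\<gamma> t)" for t
  define m' where "m' t = D (\<gamma> t) (g' t)" for t
  have m': "(m has_vector_derivative m' t) (at t within {0..\<epsilon>1})" if t: "t \<in> {0..\<epsilon>1}" for t
  proof -
    have g: "(\<gamma> has_vector_derivative g' t) (at t within {0..\<epsilon>1})"
      by (rule has_vector_derivative_within_subset[OF g']) (use t \<epsilon>1 in auto)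
    have "(N has_derivative blinfun_apply (D (\<gamma> t))) (at (\<gamma> t) within \<gamma> ` {0..\<epsilon>1})"
      by (rule has_derivative_subset[OF DN[OF \<gamma>V[OF t]]]) (use \<gamma>S \<epsilon>1 in auto)
    from vector_derivative_diff_chain_within[OF g this] show ?thesis
      by (simp add: o_def m_def[abs_def] m'_def)
  qed
  have sub1: "continuous_on {0..\<epsilon>1} \<gamma>" "continuous_on {0..\<epsilon>1} g'"
    using continuous_on_subset[OF c\<gamma>] continuous_on_subset[OF cg'] \<epsilon>1 by auto
  have "continuous_on {0..\<epsilon>1} (\<lambda>t. D (\<gamma> t))"
    using \<gamma>V by (intro continuous_on_compose2[OF D sub1(1)]) auto
  then have cm': "continuous_on {0..\<epsilon>1} m'"
    unfolding m'_def[abs_def] by (intro continuous_intros sub1)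
  have cm: "continuous_on {0..\<epsilon>1} m"
    using m' has_vector_derivative_continuous continuous_on_eq_continuous_within by blast
  have mm: "m t \<bullet> m t = 1" if "t \<in> {0..\<epsilon>1}" for t
    using N \<gamma>V[OF that] T by (simp add: m_def unit_normal_field_def dot_square_norm)
  have m'm: "m' t \<bullet> m t = 0" if t: "t \<in> {0..\<epsilon>1}" for t
    using D_perp[OF \<gamma>V[OF t]] by (simp add: m_def m'_def)
  have g'm: "g' t \<bullet> m t = 0" if t: "t \<in> {0..\<epsilon>1}" for t
    using velocity_perp_normal[OF S N _ l \<gamma>S g'] t \<epsilon>1 by (auto simp: m_def)
  define c where "c t = \<gamma> t + r *\<^sub>R m t" for t
  define c' where "c' t = g' t + r *\<^sub>R m' t" for t
  have cc': "continuous_on {0..\<epsilon>1} c'"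
    unfolding c'_def[abs_def] by (intro continuous_intros sub1 cm')
  have c'm: "c' t \<bullet> m t = 0" if "t \<in> {0..\<epsilon>1}" for t
    using m'm[OF that] g'm[OF that] by (simp add: c'_def inner_add_left)
  have c'0: "c' 0 = v + r *\<^sub>R D p v"
    using \<gamma> by (simp add: c'_def m'_def g'_def)
  obtain \<epsilon>2 where \<epsilon>2: "0 < \<epsilon>2" "\<epsilon>2 \<le> \<epsilon>1" "c' ` {0..\<epsilon>2} \<subseteq> - {0}"
    using short_initial_interval[OF \<epsilon>1(1) cc', of "- {0}"] c'0 ne by auto
  define \<omega> where "\<omega> t = (1 / r) *\<^sub>R cross3 (m t) (c' t)" for t
  have "continuous_on {0..\<epsilon>1} \<omega>"
    unfolding \<omega>_def[abs_def] by (intro continuous_intros continuous_on_cross cm cc')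
  then have "continuous_on {0..\<epsilon>2} \<omega>"
    using \<epsilon>2 continuous_on_subset by force
  from rotation_with_angular_velocity[OF \<epsilon>2(1) this] obtain \<epsilon> A
    where \<epsilon>: "0 < \<epsilon>" "\<epsilon> \<le> \<epsilon>2" and A0: "A 0 = mat 1"
      and rot: "\<And>t. t \<in> {0..\<epsilon>} \<Longrightarrow> rotation_matrix (A t)"
      and A: "\<And>t. t \<in> {0..\<epsilon>} \<Longrightarrow>
        (A has_vector_derivative cross_matrix (\<omega> t) ** A t) (at t within {0..\<epsilon>})"
    by metis
  have in1: "t \<in> {0..\<epsilon>1}" if "t \<in> {0..\<epsilon>}" for t
    using that \<epsilon> \<epsilon>2 by auto
  have c'_nonzero: "c' t \<noteq> 0" if "t \<in> {0..\<epsilon>}" for t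
    using that \<epsilon> \<epsilon>2 by (auto simp: image_subset_iff)
  have \<omega>m: "cross3 (\<omega> t) (r *\<^sub>R m t) = c' t" if "t \<in> {0..\<epsilon>}" for t
    using cross3_cross3_same[of "m t" "c' t"] mm[OF in1[OF that]] c'm[OF in1[OF that]] r
    by (simp add: \<omega>_def cross_mult_left cross_mult_right inner_commute)
  let ?c = "ball_center N p r"
  define b where "b t = c t - A t *v ?c" for t
  have rigid_c: "rigid A b t ?c = c t" for t
    by (simp add: rigid_def b_def)
  have c: "(c has_vector_derivative c' t) (at t within {0..\<epsilon>})" if t: "t \<in> {0..\<epsilon>}" for t
  proof -
    have "(\<gamma> has_vector_derivative g' t) (at t within {0..\<epsilon>})"
      by (rule has_vector_derivative_within_subset[OF g']) (use t \<epsilon> \<epsilon>1 \<epsilon>2 in auto)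
    moreover have "(m has_vector_derivative m' t) (at t within {0..\<epsilon>})"
      by (rule has_vector_derivative_within_subset[OF m']) (use t \<epsilon> \<epsilon>1 \<epsilon>2 in auto)
    then have "((\<lambda>t. r *\<^sub>R m t) has_vector_derivative r *\<^sub>R m' t) (at t within {0..\<epsilon>})"
      by (rule bounded_linear.has_vector_derivative[OF bounded_linear_scaleR_right])
    ultimately show ?thesis
      unfolding c_def[abs_def] c'_def by (rule has_vector_derivative_add)
  qed
  have b: "(b has_vector_derivative c' t - (cross_matrix (\<omega> t) ** A t) *v ?c) (at t within {0..\<epsilon>})"
    if "t \<in> {0..\<epsilon>}" for t
    unfolding b_def[abs_def]
    by (intro has_vector_derivative_diff c has_vector_derivative_matrix_vector_mult A that)
  have cA: "continuous_on {0..\<epsilon>} A"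
    using A has_vector_derivative_continuous continuous_on_eq_continuous_within by blast
  have "continuous_on {0..\<epsilon>} \<omega>"
    using \<open>continuous_on {0..\<epsilon>2} \<omega>\<close> \<epsilon> continuous_on_subset by force
  then have cA': "continuous_on {0..\<epsilon>} (\<lambda>t. cross_matrix (\<omega> t) ** A t)"
    by (intro bounded_bilinear.continuous_on[OF bounded_bilinear_matrix_matrix_mult]
        continuous_on_cross_matrix cA)
  then have "continuous_on {0..\<epsilon>} (\<lambda>t. (cross_matrix (\<omega> t) ** A t) *v ?c)"
    by (intro bounded_bilinear.continuous_on[OF bounded_bilinear_matrix_vector_mult] continuous_on_const)
  moreover have "continuous_on {0..\<epsilon>} c'"
    using cc' in1 continuous_on_subset by (metis subsetI)
  ultimately have cb': "continuous_on {0..\<epsilon>} (\<lambda>t. c' t - (cross_matrix (\<omega> t) ** A t) *v ?c)"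
    by (rule continuous_on_diff[rotated])
  have part: "rotational_part \<epsilon> A t = cross_matrix (\<omega> t)" if t: "t \<in> {0..\<epsilon>}" for t
  proof -
    have "velocity {0..\<epsilon>} A t = cross_matrix (\<omega> t) ** A t"
      by (rule velocity_eq[OF \<epsilon>(1) t A[OF t]])
    moreover have "A t ** transpose (A t) = mat 1"
      using rot[OF t] by (simp add: rotation_matrix_def orthogonal_matrix_def)
    ultimately show ?thesis
      by (simp add: rotational_part_def flip: matrix_mul_assoc)
  qed
  have tangent: "tangent_at (rigid A b t ` rolling_sphere N p r) S (\<gamma> t)" if t: "t \<in> {0..\<epsilon>}" for t
  proof -
    have qS: "\<gamma> t \<in> S"
      using \<gamma>V[OF in1[OF t]] T by auto
    have "norm (m t) = 1"
      using mm[OF in1[OF t]] by (simp add: norm_eq_1)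
    then have mem: "\<gamma> t \<in> sphere (c t) \<bar>r\<bar>"
      by (simp add: c_def dist_norm)
    have "\<gamma> t - c t = - (r *\<^sub>R N (\<gamma> t))"
      by (simp add: c_def m_def)
    then have "tangent_space (sphere (c t) \<bar>r\<bar>) (\<gamma> t) = tangent_space S (\<gamma> t)"
      using tangent_space_sphere[OF _ mem] tangent_space_perp_normal[OF S N qS] r by simp
    then show ?thesis
      using mem qS rigid_image_sphere[of A t b ?c "\<bar>r\<bar>", OF rot[OF t]]
      by (simp add: tangent_at_def rolling_sphere_def rigid_c)
  qed
  have still: "instantaneous_motion \<epsilon> A b t (\<gamma> t) = 0" if t: "t \<in> {0..\<epsilon>}" for t
  proof -
    define y where "y = inv (rigid A b t) (\<gamma> t)"
    have "rigid A b t (transpose (A t) *v (z - b t)) = z" for z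
      by (simp add: rigid_def rotation_matrix_surj[OF rot[OF t]] del: transpose_matrix_vector)
    then have "surj (rigid A b t)"
      by (rule surjI)
    then have y: "rigid A b t y = \<gamma> t"
      unfolding y_def by (rule surj_f_inv_f)
    let ?Q = "cross_matrix (\<omega> t)"
    have "((\<lambda>s. rigid A b s y) has_vector_derivative
        (?Q ** A t) *v y + (c' t - (?Q ** A t) *v ?c)) (at t within {0..\<epsilon>})"
      unfolding rigid_def
      by (intro has_vector_derivative_add has_vector_derivative_matrix_vector_mult A b t)
    then have "instantaneous_motion \<epsilon> A b t (\<gamma> t) = (?Q ** A t) *v y + (c' t - (?Q ** A t) *v ?c)"
      unfolding instantaneous_motion_def y_def[symmetric] by (rule velocity_eq[OF \<epsilon>(1) t])
    also have "\<dots> = cross3 (\<omega> t) (A t *v y - A t *v ?c) + c' t"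
      by (simp add: cross_matrix_mult right_diff_distrib Cross3.right_diff_distrib
          flip: matrix_vector_mul_assoc)
    also have "A t *v y - A t *v ?c = - (r *\<^sub>R m t)"
      using y by (simp add: rigid_def b_def c_def algebra_simps)
    also have "cross3 (\<omega> t) (- (r *\<^sub>R m t)) + c' t = 0"
      using \<omega>m[OF t] by simp
    finally show ?thesis .
  qed
  have nonzero: "rotational_part \<epsilon> A t \<noteq> 0" if t: "t \<in> {0..\<epsilon>}" for t
  proof
    assume "rotational_part \<epsilon> A t = 0"
    then have "cross_matrix (\<omega> t) *v (r *\<^sub>R m t) = 0"
      using part[OF t] by (simp add: matrix_vector_mult_def vec_eq_iff)
    then show False
      using \<omega>m[OF t] c'_nonzero[OF t] by (simp add: cross_matrix_mult)
  qed
  have "angular_velocity \<epsilon> A t \<in> tangent_space S (\<gamma> t)" if t: "t \<in> {0..\<epsilon>}" for t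
  proof -
    have "\<omega> t \<bullet> N (\<gamma> t) = 0"
      by (simp add: \<omega>_def m_def dot_cross_self)
    then show ?thesis
      using angular_velocity_eq[OF part[OF t]] tangent_space_perp_normal[OF S N] \<gamma>V[OF in1[OF t]] T
      by auto
  qed
  moreover have "rigid A b 0 = id"
    using \<gamma> by (auto simp: fun_eq_iff rigid_def b_def c_def m_def A0 ball_center_def)
  ultimately have "rolling (rolling_sphere N p r) S \<gamma> \<epsilon> A b"
    using C1_curve_onI[OF \<epsilon>(1) A cA'] C1_curve_onI[OF \<epsilon>(1) b cb'] rot tangent still nonzero
    unfolding rolling_def rotational_motion_def motion_def by blast
  moreover have "speed \<epsilon> A b ?c 0 = norm (v + r *\<^sub>R D p v)"
    using velocity_eq[OF \<epsilon>(1) _ c] \<epsilon> by (simp add: speed_def rigid_c c'0)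
  moreover have "\<epsilon> \<le> l"
    using \<epsilon> \<epsilon>1 \<epsilon>2 by simp
  ultimately show ?thesis
    unfolding rolls_with_initial_speed_def using \<epsilon>(1) by blast
qed

section \<open>Curvature at a point\<close>

text \<open>A binary quadratic form with three zeros on the projective line vanishes: the determinant of the
  linear system for its coefficients is, up to the factor 2, the product of the three
  two-by-two determinants.\<close>

lemma binary_quadratic_form_zero:
  fixes A B C :: real
  assumes "A * x1\<^sup>2 + 2 * B * x1 * y1 + C * y1\<^sup>2 = 0"
    and "A * x2\<^sup>2 + 2 * B * x2 * y2 + C * y2\<^sup>2 = 0"
    and "A * x3\<^sup>2 + 2 * B * x3 * y3 + C * y3\<^sup>2 = 0"
    and "x1 * y2 - x2 * y1 \<noteq> 0" "x1 * y3 - x3 * y1 \<noteq> 0" "x2 * y3 - x3 * y2 \<noteq> 0"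
  shows "A = 0" "B = 0" "C = 0"
proof -
  let ?V = "(x1 * y2 - x2 * y1) * (x1 * y3 - x3 * y1) * (x2 * y3 - x3 * y2)"
  have "A * ?V = 0" "B * ?V = 0" "C * ?V = 0"
    using assms(1-3) by algebra+
  with assms(4-6) show "A = 0" "B = 0" "C = 0"
    by auto
qed

lemma cross3_inner_cross3:
  "cross3 a b \<bullet> cross3 c d = (a \<bullet> c) * (b \<bullet> d) - (a \<bullet> d) * (b \<bullet> c)"
  by (simp add: cross3_simps)

lemma orthonormal_frame:
  fixes n :: "real^3"
  assumes n: "norm n = 1"
  obtains e1 e2 where "e1 \<bullet> e1 = 1" "e2 \<bullet> e2 = 1" "e1 \<bullet> e2 = 0" "e1 \<bullet> n = 0" "e2 \<bullet> n = 0"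
    "\<And>v. v \<bullet> n = 0 \<Longrightarrow> v = (v \<bullet> e1) *\<^sub>R e1 + (v \<bullet> e2) *\<^sub>R e2"
proof -
  have nn: "n \<bullet> n = 1"
    using n by (simp add: dot_square_norm)
  obtain y where y: "y \<noteq> 0" "orthogonal n y"
    using orthogonal_to_vector_exists[of n] by auto
  define e1 where "e1 = sgn y"
  define e2 where "e2 = cross3 n e1"
  have e11: "e1 \<bullet> e1 = 1"
    using y by (simp add: e1_def dot_square_norm norm_sgn)
  have e1n: "e1 \<bullet> n = 0" "n \<bullet> e1 = 0"
    using y by (simp_all add: e1_def sgn_div_norm orthogonal_def inner_commute)
  have e22: "e2 \<bullet> e2 = 1"
    by (simp add: e2_def cross3_inner_cross3 nn e11 e1n)
  have e2n: "e2 \<bullet> n = 0" "e1 \<bullet> e2 = 0"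
    by (simp_all add: e2_def dot_cross_self)
  have "v = (v \<bullet> e1) *\<^sub>R e1 + (v \<bullet> e2) *\<^sub>R e2" if "v \<bullet> n = 0" for v
  proof -
    have "n \<bullet> v = 0"
      using that by (simp add: inner_commute)
    then have "cross3 v e1 \<bullet> e2 = 0" "cross3 n v \<bullet> e2 = v \<bullet> e1"
      using that by (simp_all add: e2_def cross3_inner_cross3 nn e11 e1n)
    then show ?thesis
      using cross3_Cramer[of v e1 n] e22 by (simp flip: e2_def)
  qed
  then show thesis
    using that[OF e11 e22 e2n(2) e1n(1) e2n(1)] by blast
qed

text \<open>A point \<open>p\<close> of the surface together with the derivative \<open>D\<close> of the normal field near \<open>p\<close>, an
  orthonormal basis \<open>e1\<close>, \<open>e2\<close> of the tangent plane at \<open>p\<close>, and the symmetric matrix with entries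
  \<open>a\<close>, \<open>b\<close>, \<open>d\<close> of the shape operator \<open>- D p\<close> in this basis.\<close>

locale surface_point =
  fixes S :: "(real^3) set" and N :: "real^3 \<Rightarrow> real^3" and p :: "real^3"
    and V :: "(real^3) set" and D :: "real^3 \<Rightarrow> (real^3) \<Rightarrow>\<^sub>L (real^3)"
    and e1 e2 :: "real^3" and a b d :: real
  assumes S: "C2_surface S" and N: "unit_normal_field S N" and p: "p \<in> S"
    and V: "openin (top_of_set S) V" "p \<in> V"
    and DN: "\<And>q. q \<in> V \<Longrightarrow> (N has_derivative blinfun_apply (D q)) (at q within S)"
    and D: "continuous_on V D"
    and D_perp: "\<And>q w. q \<in> V \<Longrightarrow> D q w \<bullet> N q = 0"
    and frame: "e1 \<bullet> e1 = 1" "e2 \<bullet> e2 = 1" "e1 \<bullet> e2 = 0" "e1 \<bullet> N p = 0" "e2 \<bullet> N p = 0"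
    and span: "\<And>v. v \<bullet> N p = 0 \<Longrightarrow> v = (v \<bullet> e1) *\<^sub>R e1 + (v \<bullet> e2) *\<^sub>R e2"
    and shape: "D p e1 = - (a *\<^sub>R e1 + b *\<^sub>R e2)" "D p e2 = - (b *\<^sub>R e1 + d *\<^sub>R e2)"
begin

text \<open>The second fundamental form.\<close>

definition II :: "real \<Rightarrow> real \<Rightarrow> real" where
  "II x y = a * x\<^sup>2 + 2 * b * x * y + d * y\<^sup>2"

definition h where "h = (a + d) / 2"
definition K where "K = a * d - b\<^sup>2"

text \<open>Half the difference of the eigenvalues of the shape operator.\<close>

definition R where "R = sqrt (((a - d) / 2)\<^sup>2 + b\<^sup>2)"

definition tvec where "tvec x y = x *\<^sub>R e1 + y *\<^sub>R e2"

lemma e21: "e2 \<bullet> e1 = 0"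
  using frame by (simp add: inner_commute)

lemma inner_tvec: "tvec x y \<bullet> tvec x' y' = x * x' + y * y'"
  by (simp add: tvec_def inner_add_left inner_add_right frame e21)

lemma norm_tvec: "norm (tvec x y) = sqrt (x\<^sup>2 + y\<^sup>2)"
  by (simp add: norm_eq_sqrt_inner inner_tvec power2_eq_square)

lemma tvec_perp: "tvec x y \<bullet> N p = 0"
  by (simp add: tvec_def inner_add_left frame)

lemma D_tvec: "D p (tvec x y) = - tvec (a * x + b * y) (b * x + d * y)"
  by (simp add: tvec_def blinfun.add_right blinfun.scaleR_right shape algebra_simps)

lemma unit_tangent_tvec:
  assumes "v \<bullet> N p = 0" "norm v = 1"
  obtains x y where "v = tvec x y" "x\<^sup>2 + y\<^sup>2 = 1"
proof -
  have v: "v = tvec (v \<bullet> e1) (v \<bullet> e2)"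
    using span[OF assms(1)] by (simp add: tvec_def)
  moreover from this have "(v \<bullet> e1)\<^sup>2 + (v \<bullet> e2)\<^sup>2 = 1"
    using norm_tvec assms(2) by (metis real_sqrt_eq_1_iff)
  ultimately show thesis
    using that by blast
qed

lemma unit_speed_velocity:
  assumes "unit_speed_curve S l \<gamma>" "\<gamma> 0 = p"
  obtains x y where "velocity {0..l} \<gamma> 0 = tvec x y" "x\<^sup>2 + y\<^sup>2 = 1"
proof (rule unit_tangent_tvec)
  have "0 < l" "C1_curve_on {0..l} \<gamma>" "\<gamma> ` {0..l} \<subseteq> S"
    using assms by (auto simp: unit_speed_curve_def C2_curve_on_def)
  then show "velocity {0..l} \<gamma> 0 \<bullet> N p = 0"
    using velocity_perp_normal[OF S N, of 0 0 l \<gamma>] has_velocity[of "{0..l}" \<gamma> 0] assms by simp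
  show "norm (velocity {0..l} \<gamma> 0) = 1"
    using assms by (auto simp: unit_speed_curve_def)
qed

text \<open>Differentiating the orthogonality of \<open>\<gamma>'\<close> and the normal along \<open>\<gamma>\<close> relates the acceleration to the
  derivative of the normal field.\<close>

lemma normal_curvature:
  assumes \<gamma>: "unit_speed_curve S l \<gamma>" "\<gamma> 0 = p" "velocity {0..l} \<gamma> 0 = tvec x y"
  shows "velocity {0..l} (velocity {0..l} \<gamma>) 0 \<bullet> N p = II x y"
proof -
  let ?v = "velocity {0..l} \<gamma>" and ?a = "velocity {0..l} (velocity {0..l} \<gamma>)"
  have *: "0 < l" "C1_curve_on {0..l} \<gamma>" "C1_curve_on {0..l} ?v" "\<gamma> ` {0..l} \<subseteq> S"
    using \<gamma> by (auto simp: unit_speed_curve_def C2_curve_on_def)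
  then have 0: "0 \<in> {0..l}"
    by simp
  have "(N has_derivative blinfun_apply (D p)) (at (\<gamma> 0) within \<gamma> ` {0..l})"
    using has_derivative_subset[OF DN[OF V(2)] *(4)] \<gamma> by simp
  from vector_derivative_diff_chain_within[OF has_velocity[OF *(2) 0] this]
  have N': "((\<lambda>t. N (\<gamma> t)) has_vector_derivative D p (?v 0)) (at 0 within {0..l})"
    by (simp add: o_def)
  have d1: "((\<lambda>t. ?v t \<bullet> N (\<gamma> t)) has_vector_derivative (?v 0 \<bullet> D p (?v 0) + ?a 0 \<bullet> N p)) (at 0 within {0..l})"
    using bounded_bilinear.has_vector_derivative[OF bounded_bilinear_inner has_velocity[OF *(3) 0] N'] \<gamma>
    by simp
  have d2: "((\<lambda>t. ?v t \<bullet> N (\<gamma> t)) has_vector_derivative 0) (at 0 within {0..l})"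
  proof (rule has_vector_derivative_transform[OF 0 _ has_vector_derivative_const])
    show "?v t \<bullet> N (\<gamma> t) = 0" if "t \<in> {0..l}" for t
      using velocity_perp_normal[OF S N that *(1,4) has_velocity[OF *(2) that]] .
  qed
  have "?v 0 \<bullet> D p (?v 0) + ?a 0 \<bullet> N p = 0"
    using velocity_eq[OF *(1) 0 d1] velocity_eq[OF *(1) 0 d2] by simp
  moreover have "?v 0 \<bullet> D p (?v 0) = - II x y"
    by (simp add: \<gamma> D_tvec inner_tvec II_def power2_eq_square algebra_simps)
  ultimately show ?thesis
    by simp
qed

lemma normal_curvatures_eq: "normal_curvatures S N p = {II x y | x y. x\<^sup>2 + y\<^sup>2 = 1}"
proof
  show "normal_curvatures S N p \<subseteq> {II x y | x y. x\<^sup>2 + y\<^sup>2 = 1}"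
  proof
    fix k assume "k \<in> normal_curvatures S N p"
    then obtain l \<gamma> where k: "k = velocity {0..l} (velocity {0..l} \<gamma>) 0 \<bullet> N p"
      and \<gamma>: "unit_speed_curve S l \<gamma>" "\<gamma> 0 = p"
      unfolding normal_curvatures_def by blast
    obtain x y where xy: "velocity {0..l} \<gamma> 0 = tvec x y" "x\<^sup>2 + y\<^sup>2 = 1"
      using unit_speed_velocity[OF \<gamma>] .
    show "k \<in> {II x y | x y. x\<^sup>2 + y\<^sup>2 = 1}"
      using normal_curvature[OF \<gamma> xy(1)] k xy(2) by blast
  qed
  show "{II x y | x y. x\<^sup>2 + y\<^sup>2 = 1} \<subseteq> normal_curvatures S N p"
  proof
    fix k assume "k \<in> {II x y | x y. x\<^sup>2 + y\<^sup>2 = 1}"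
    then obtain x y where k: "k = II x y" "x\<^sup>2 + y\<^sup>2 = 1"
      by blast
    have "norm (tvec x y) = 1"
      using k by (simp add: norm_tvec)
    then obtain l \<gamma> where "unit_speed_curve S l \<gamma>" "\<gamma> 0 = p" "velocity {0..l} \<gamma> 0 = tvec x y"
      using unit_speed_curve_exists[OF S N p tvec_perp] by blast
    then show "k \<in> normal_curvatures S N p"
      unfolding normal_curvatures_def k(1) using normal_curvature[of l \<gamma> x y]
      by (intro CollectI exI[of _ l] exI[of _ \<gamma>]) simp
  qed
qed

text \<open>In terms of the doubled angle the second fundamental form of a unit vector is an affine
  function on the unit circle, whose extreme values can be read off.\<close>

lemma II_double_angle:
  assumes "x\<^sup>2 + y\<^sup>2 = 1"
  shows "II x y = h + ((a - d) / 2) * (x\<^sup>2 - y\<^sup>2) + b * (2 * x * y)"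
proof -
  have "a * x\<^sup>2 + d * y\<^sup>2 = (a + d) / 2 * (x\<^sup>2 + y\<^sup>2) + ((a - d) / 2) * (x\<^sup>2 - y\<^sup>2)"
    by (simp add: field_simps)
  then show ?thesis
    using assms by (simp add: II_def h_def)
qed

lemma R_squared: "R\<^sup>2 = ((a - d) / 2)\<^sup>2 + b\<^sup>2"
  by (simp add: R_def)

lemma II_bounds:
  assumes "x\<^sup>2 + y\<^sup>2 = 1"
  shows "\<bar>II x y - h\<bar> \<le> R"
proof -
  let ?m = "(a - d) / 2" and ?P = "x\<^sup>2 - y\<^sup>2" and ?Q = "2 * x * y"
  have "?P\<^sup>2 + ?Q\<^sup>2 = (x\<^sup>2 + y\<^sup>2)\<^sup>2"
    by algebra
  then have PQ: "?P\<^sup>2 + ?Q\<^sup>2 = 1"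
    using assms by simp
  have "(m * P + b * Q)\<^sup>2 \<le> (m\<^sup>2 + b\<^sup>2) * (P\<^sup>2 + Q\<^sup>2)" for m P Q :: real
  proof -
    have "(m\<^sup>2 + b\<^sup>2) * (P\<^sup>2 + Q\<^sup>2) = (m * P + b * Q)\<^sup>2 + (m * Q - b * P)\<^sup>2"
      by algebra
    then show ?thesis
      by (metis le_add_same_cancel1 zero_le_power2)
  qed
  from this[of ?m ?P ?Q] have "(?m * ?P + b * ?Q)\<^sup>2 \<le> R\<^sup>2"
    unfolding PQ R_squared by (simp only: mult_1_right)
  moreover have "II x y - h = ?m * ?P + b * ?Q"
    using II_double_angle[OF assms] by simp
  moreover have "0 \<le> R"
    by (simp add: R_def)
  ultimately show ?thesis
    by (metis abs_le_square_iff abs_of_nonneg)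
qed

text \<open>The extreme values of a linear function on the circle lie in the direction of its gradient; the
  vector sought has half that angle. A quarter turn of the vector turns the doubled angle
  by a half turn and so leads from the maximum to the minimum.\<close>

lemma II_attains:
  obtains x y where "x\<^sup>2 + y\<^sup>2 = 1" "II x y = h + R" "II (- y) x = h - R"
proof (cases "R = 0")
  case True
  have "\<bar>II 1 0 - h\<bar> \<le> R" "\<bar>II (- 0) 1 - h\<bar> \<le> R"
    by (rule II_bounds; simp)+
  then show thesis
    using that[of 1 0] True by simp
next
  case False
  let ?m = "(a - d) / 2"
  have "(?m / R)\<^sup>2 + (b / R)\<^sup>2 = (?m\<^sup>2 + b\<^sup>2) / R\<^sup>2"
    by (simp add: power_divide add_divide_distrib)
  also have "\<dots> = 1"
    using False unfolding R_squared[symmetric] by simp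
  finally have "(?m / R)\<^sup>2 + (b / R)\<^sup>2 = 1" .
  then obtain t where t: "?m / R = cos t" "b / R = sin t"
    using sincos_total_2pi by blast
  define x y where "x = cos (t / 2)" and "y = sin (t / 2)"
  have xy: "x\<^sup>2 + y\<^sup>2 = 1" "(- y)\<^sup>2 + x\<^sup>2 = 1"
    by (simp_all add: x_def y_def)
  have P: "x\<^sup>2 - y\<^sup>2 = ?m / R" and Q: "2 * x * y = b / R"
    using t cos_double[of "t / 2"] sin_double[of "t / 2"] by (simp_all add: x_def y_def)
  have sum: "?m * (?m / R) + b * (b / R) = R"
  proof -
    have "?m * (?m / R) + b * (b / R) = R\<^sup>2 / R"
      unfolding R_squared by (simp add: power2_eq_square add_divide_distrib)
    then show ?thesis
      by (simp add: power2_eq_square)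
  qed
  show thesis
  proof
    show "x\<^sup>2 + y\<^sup>2 = 1"
      by (rule xy)
    have "II x y = h + ?m * (?m / R) + b * (b / R)"
      using II_double_angle[OF xy(1)] unfolding P Q .
    then show "II x y = h + R"
      using sum by simp
    have "(- y)\<^sup>2 - x\<^sup>2 = - (?m / R)" "2 * (- y) * x = - (b / R)"
      using P Q by (simp_all add: algebra_simps)
    then have "II (- y) x = h + ?m * (- (?m / R)) + b * (- (b / R))"
      using II_double_angle[OF xy(2)] by simp
    then show "II (- y) x = h - R"
      using sum by simp
  qed
qed

lemma principal_curvatures:
  "principal_curvature1 S N p = h + R" "principal_curvature2 S N p = h - R"
proof -
  obtain x y where xy: "x\<^sup>2 + y\<^sup>2 = 1" "II x y = h + R" "II (- y) x = h - R"
    by (rule II_attains)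
  have mem: "h + R \<in> normal_curvatures S N p" "h - R \<in> normal_curvatures S N p"
  proof -
    show "h + R \<in> normal_curvatures S N p"
      unfolding normal_curvatures_eq using xy by (intro CollectI exI[of _ x] exI[of _ y]) simp
    show "h - R \<in> normal_curvatures S N p"
      unfolding normal_curvatures_eq using xy by (intro CollectI exI[of _ "- y"] exI[of _ x]) simp
  qed
  have bound: "h - R \<le> k \<and> k \<le> h + R" if "k \<in> normal_curvatures S N p" for k
    using that II_bounds unfolding normal_curvatures_eq by fastforce
  show "principal_curvature1 S N p = h + R"
    unfolding principal_curvature1_def by (rule Greatest_equality) (use mem bound in auto)
  show "principal_curvature2 S N p = h - R"
    unfolding principal_curvature2_def by (rule Least_equality) (use mem bound in auto)
qed

lemma mean_curvature_eq: "mean_curvature S N p = h"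
  by (simp add: mean_curvature_def principal_curvatures)

lemma umbilic_iff: "umbilic S N p \<longleftrightarrow> R = 0"
  by (auto simp: umbilic_def principal_curvatures)

lemma umbilic_iff_entries: "umbilic S N p \<longleftrightarrow> a = d \<and> b = 0"
  unfolding umbilic_iff R_def by (auto simp: add_nonneg_eq_0_iff)

lemma R_h_K: "R\<^sup>2 = h\<^sup>2 - K"
  unfolding R_squared h_def K_def by (simp add: power2_eq_square field_simps)

text \<open>This is the Cayley-Hamilton theorem for the shape operator \<open>W\<close>: expanding the square of
  \<open>v - r W v\<close> produces \<open>II\<close> and the square of \<open>W v\<close>, and \<open>W\<^sup>2 = 2 h W - K\<close> reduces the latter to
  \<open>2 h II - K\<close>. The speed therefore depends on the direction through \<open>II\<close> only, and
  for \<open>r \<noteq> 0\<close> the coefficient of \<open>II\<close> vanishes exactly when \<open>h = 1 / r\<close>.\<close>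

lemma norm_center_velocity:
  assumes "x\<^sup>2 + y\<^sup>2 = 1"
  shows "(norm (tvec x y + r *\<^sub>R D p (tvec x y)))\<^sup>2 = 1 - r\<^sup>2 * K + 2 * r * (h * r - 1) * II x y"
proof -
  have "tvec x y + r *\<^sub>R D p (tvec x y) = tvec (x - r * (a * x + b * y)) (y - r * (b * x + d * y))"
    by (simp add: D_tvec) (simp add: tvec_def algebra_simps)
  then have "(norm (tvec x y + r *\<^sub>R D p (tvec x y)))\<^sup>2
      = (x - r * (a * x + b * y))\<^sup>2 + (y - r * (b * x + d * y))\<^sup>2"
    by (simp add: norm_tvec)
  also have "\<dots> = (1 - r\<^sup>2 * K) * (x\<^sup>2 + y\<^sup>2) + 2 * r * (h * r - 1) * II x y"
    unfolding K_def h_def II_def by (simp add: field_simps power2_eq_square)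
  finally show ?thesis
    using assms by simp
qed

lemma initial_speed_squared:
  assumes "r \<noteq> 0" "unit_speed_curve S l \<gamma>" "\<gamma> 0 = p"
    and "velocity {0..l} \<gamma> 0 = tvec x y" "x\<^sup>2 + y\<^sup>2 = 1"
    and "rolls_with_initial_speed S N p r \<gamma> l \<sigma>"
  shows "\<sigma>\<^sup>2 = 1 - r\<^sup>2 * K + 2 * r * (h * r - 1) * II x y"
  using initial_speed[OF S N assms(1) DN[OF V(2)] assms(2,3,6)] norm_center_velocity[OF assms(5)] assms(4)
  by simp

lemma nonparallel_tvec:
  assumes "nonparallel (tvec x y) (tvec x' y')"
  shows "x * y' - x' * y \<noteq> 0"
proof
  assume "x * y' - x' * y = 0"
  then have "cross3 (tvec x y) (tvec x' y') = 0"
    by (simp add: tvec_def cross_add_left cross_add_right cross_mult_left cross_mult_right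
        cross_skew[of e2 e1] algebra_simps flip: scaleR_diff_left)
  then show False
    using assms by (simp add: nonparallel_def cross_eq_0)
qed

section \<open>Isotropic rolling\<close>

text \<open>The form \<open>II - k \<langle>\<cdot>,\<cdot>\<rangle>\<close> has three zeros on the projective line.\<close>

lemma equal_II_imp_umbilic:
  assumes "x1\<^sup>2 + y1\<^sup>2 = 1" "x2\<^sup>2 + y2\<^sup>2 = 1" "x3\<^sup>2 + y3\<^sup>2 = 1"
    and "x1 * y2 - x2 * y1 \<noteq> 0" "x1 * y3 - x3 * y1 \<noteq> 0" "x2 * y3 - x3 * y2 \<noteq> 0"
    and "II x1 y1 = k" "II x2 y2 = k" "II x3 y3 = k"
  shows "umbilic S N p"
proof -
  have *: "(a - k) * x\<^sup>2 + 2 * b * x * y + (d - k) * y\<^sup>2 = 0" if "x\<^sup>2 + y\<^sup>2 = 1" "II x y = k" for x y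
  proof -
    have "(a - k) * x\<^sup>2 + 2 * b * x * y + (d - k) * y\<^sup>2 = II x y - k * (x\<^sup>2 + y\<^sup>2)"
      by (simp add: II_def algebra_simps)
    then show ?thesis
      using that by simp
  qed
  have "a - k = 0" "b = 0" "d - k = 0"
    using binary_quadratic_form_zero[OF *[OF assms(1,7)] *[OF assms(2,8)] *[OF assms(3,9)] assms(4-6)]
    by blast+
  then show ?thesis
    unfolding umbilic_iff_entries by simp
qed

lemma equal_speeds_imp:
  assumes r: "r \<noteq> 0"
    and xy: "x1\<^sup>2 + y1\<^sup>2 = 1" "x2\<^sup>2 + y2\<^sup>2 = 1" "x3\<^sup>2 + y3\<^sup>2 = 1"
    and ne: "x1 * y2 - x2 * y1 \<noteq> 0" "x1 * y3 - x3 * y1 \<noteq> 0" "x2 * y3 - x3 * y2 \<noteq> 0"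
    and eq: "s = 1 - r\<^sup>2 * K + 2 * r * (h * r - 1) * II x1 y1"
      "s = 1 - r\<^sup>2 * K + 2 * r * (h * r - 1) * II x2 y2"
      "s = 1 - r\<^sup>2 * K + 2 * r * (h * r - 1) * II x3 y3"
  shows "umbilic S N p \<or> mean_curvature S N p = 1 / r"
proof (cases "h * r = 1")
  case True
  then show ?thesis
    using r by (simp add: mean_curvature_eq field_simps)
next
  case False
  then have "2 * r * (h * r - 1) \<noteq> 0"
    using r by simp
  then have "II x2 y2 = II x1 y1" "II x3 y3 = II x1 y1"
    using eq by auto
  then show ?thesis
    using equal_II_imp_umbilic[OF xy ne] by blast
qed

text \<open>Positivity of the common speed is what makes the sphere roll at all.\<close>

lemma rolls_isotropicallyI:
  assumes r: "r \<noteq> 0" and C: "0 < C"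
    and speed: "\<And>x y. x\<^sup>2 + y\<^sup>2 = 1 \<Longrightarrow> 1 - r\<^sup>2 * K + 2 * r * (h * r - 1) * II x y = C"
  shows "rolls_isotropically S N p r"
  unfolding rolls_isotropically_def
proof (intro exI[of _ "sqrt C"] ballI impI allI)
  fix v l \<gamma>
  assume "unit_speed_curve S l \<gamma> \<and> \<gamma> 0 = p \<and> velocity {0..l} \<gamma> 0 = v"
  then have \<gamma>: "unit_speed_curve S l \<gamma>" "\<gamma> 0 = p" "velocity {0..l} \<gamma> 0 = v"
    by auto
  obtain x y where xy: "v = tvec x y" "x\<^sup>2 + y\<^sup>2 = 1"
    using unit_speed_velocity[OF \<gamma>(1,2)] \<gamma>(3) by metis
  have "(norm (v + r *\<^sub>R D p v))\<^sup>2 = C"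
    using norm_center_velocity[OF xy(2)] speed[OF xy(2)] xy by simp
  then have n: "norm (v + r *\<^sub>R D p v) = sqrt C"
    by (metis norm_ge_zero real_sqrt_abs abs_of_nonneg)
  then have "v + r *\<^sub>R D p v \<noteq> 0"
    using C by auto
  from rolling_exists[OF S N r V DN D D_perp \<gamma> this] show "rolls_with_initial_speed S N p r \<gamma> l (sqrt C)"
    unfolding n .
qed

lemma umbilic_rolls_isotropically:
  assumes "umbilic S N p" "r \<noteq> 0" "r * h \<noteq> 1"
  shows "rolls_isotropically S N p r"
proof (rule rolls_isotropicallyI)
  have R: "R = 0"
    using assms umbilic_iff by simp
  show "0 < (1 - r * h)\<^sup>2"
    using assms by simp
  show "1 - r\<^sup>2 * K + 2 * r * (h * r - 1) * II x y = (1 - r * h)\<^sup>2" if "x\<^sup>2 + y\<^sup>2 = 1" for x y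
  proof -
    have "II x y = h" "K = h\<^sup>2"
      using II_bounds[OF that] R_h_K R by auto
    then show ?thesis
      by (simp add: power2_eq_square algebra_simps)
  qed
qed (use assms in auto)

text \<open>For \<open>r = 1 / h\<close> the coefficient of \<open>II\<close> in the squared speed vanishes, and the remaining constant
  \<open>1 - K / h\<^sup>2\<close> is positive because the principal curvatures differ.\<close>

lemma nonumbilic_rolls_isotropically:
  assumes "\<not> umbilic S N p" "h \<noteq> 0"
  shows "rolls_isotropically S N p (1 / h)"
proof (rule rolls_isotropicallyI)
  show "1 / h \<noteq> 0"
    using assms by simp
  have "0 < R\<^sup>2"
    using assms umbilic_iff by simp
  then show "0 < R\<^sup>2 / h\<^sup>2"
    using assms by simp
  show "1 - (1 / h)\<^sup>2 * K + 2 * (1 / h) * (h * (1 / h) - 1) * II x y = R\<^sup>2 / h\<^sup>2" for x y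
    using assms unfolding R_h_K by (simp add: field_simps)
qed

lemma nonumbilic_rolls_isotropically_imp:
  assumes "\<not> umbilic S N p" "r \<noteq> 0" "rolls_isotropically S N p r"
  shows "mean_curvature S N p = 1 / r"
proof -
  obtain \<sigma> where \<sigma>: "\<And>v l \<gamma>. \<lbrakk>v \<in> tangent_space S p; norm v = 1; unit_speed_curve S l \<gamma>; \<gamma> 0 = p;
      velocity {0..l} \<gamma> 0 = v\<rbrakk> \<Longrightarrow> rolls_with_initial_speed S N p r \<gamma> l \<sigma>"
    using assms(3) unfolding rolls_isotropically_def by blast
  have speed: "\<sigma>\<^sup>2 = 1 - r\<^sup>2 * K + 2 * r * (h * r - 1) * II x y" if xy: "x\<^sup>2 + y\<^sup>2 = 1" for x y
  proof -
    have unit: "norm (tvec x y) = 1"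
      using xy by (simp add: norm_tvec)
    obtain l \<gamma> where \<gamma>: "unit_speed_curve S l \<gamma>" "\<gamma> 0 = p" "velocity {0..l} \<gamma> 0 = tvec x y"
      using unit_speed_curve_exists[OF S N p tvec_perp unit] by blast
    have "tvec x y \<in> tangent_space S p"
      using tangent_space_perp_normal[OF S N p] tvec_perp by simp
    from initial_speed_squared[OF assms(2) \<gamma> xy \<sigma>[OF this unit \<gamma>]] show ?thesis .
  qed
  have "umbilic S N p \<or> mean_curvature S N p = 1 / r"
  \<comment> \<open>The basis vectors and a third unit vector with rational coordinates that is parallel to neither.\<close>
  proof (rule equal_speeds_imp[OF assms(2), of 1 0 0 1 "3/5" "4/5" "\<sigma>\<^sup>2"])
  qed (rule speed | simp add: power2_eq_square)+
  then show ?thesis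
    using assms(1) by blast
qed

end

lemma surface_point_exists:
  assumes S: "C2_surface S" and N: "unit_normal_field S N" and p: "p \<in> S"
  obtains V D e1 e2 a b d where "surface_point S N p V D e1 e2 a b d"
proof -
  obtain W U X Y X' X'' where c: "surface_chart S W U X Y X' X''" "p \<in> W"
    using surface_chart_exists[OF S p] by blast
  obtain V D where V: "openin (top_of_set S) V" "p \<in> V"
    and DN: "\<And>q. q \<in> V \<Longrightarrow> (N has_derivative blinfun_apply (D q)) (at q within S)"
    and D: "continuous_on V D"
    and D_perp: "\<And>q w. q \<in> V \<Longrightarrow> D q w \<bullet> N q = 0"
    and sym: "\<And>a b. a \<bullet> N p = 0 \<Longrightarrow> b \<bullet> N p = 0 \<Longrightarrow> D p a \<bullet> b = a \<bullet> D p b"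
    using surface_chart.normal_field_differentiable[OF c(1) N c(2)] by blast
  have "norm (N p) = 1"
    using N p by (simp add: unit_normal_field_def)
  then obtain e1 e2 where e: "e1 \<bullet> e1 = 1" "e2 \<bullet> e2 = 1" "e1 \<bullet> e2 = 0" "e1 \<bullet> N p = 0" "e2 \<bullet> N p = 0"
    and span: "\<And>v. v \<bullet> N p = 0 \<Longrightarrow> v = (v \<bullet> e1) *\<^sub>R e1 + (v \<bullet> e2) *\<^sub>R e2"
    using orthonormal_frame by blast
  define a b d where "a = - (D p e1 \<bullet> e1)" and "b = - (D p e1 \<bullet> e2)" and "d = - (D p e2 \<bullet> e2)"
  have "D p e2 \<bullet> e1 = - b"
    using sym[OF e(4,5)] by (simp add: b_def inner_commute)
  then have "D p e1 = - (a *\<^sub>R e1 + b *\<^sub>R e2)" "D p e2 = - (b *\<^sub>R e1 + d *\<^sub>R e2)"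
    using span[OF D_perp[OF V(2), of e1]] span[OF D_perp[OF V(2), of e2]]
    by (simp_all add: a_def b_def d_def add.commute)
  then have "surface_point S N p V D e1 e2 a b d"
    using S N p V DN D D_perp e span by (intro surface_point.intro)
  then show thesis
    by (rule that)
qed

theorem theorem1p1:
  fixes S :: "(real^3) set" and N :: "real^3 \<Rightarrow> real^3" and p :: "real^3"
  assumes "C2_surface S" and "connected S" and "unit_normal_field S N" and "p \<in> S"
  shows
    "(\<forall>r \<gamma>1 \<gamma>2 \<gamma>3 l1 l2 l3 \<sigma>.
        r \<noteq> 0 \<and>
        unit_speed_curve S l1 \<gamma>1 \<and> \<gamma>1 0 = p \<and>
        unit_speed_curve S l2 \<gamma>2 \<and> \<gamma>2 0 = p \<and>
        unit_speed_curve S l3 \<gamma>3 \<and> \<gamma>3 0 = p \<and>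
        nonparallel (velocity {0..l1} \<gamma>1 0) (velocity {0..l2} \<gamma>2 0) \<and>
        nonparallel (velocity {0..l1} \<gamma>1 0) (velocity {0..l3} \<gamma>3 0) \<and>
        nonparallel (velocity {0..l2} \<gamma>2 0) (velocity {0..l3} \<gamma>3 0) \<and>
        rolls_with_initial_speed S N p r \<gamma>1 l1 \<sigma> \<and>
        rolls_with_initial_speed S N p r \<gamma>2 l2 \<sigma> \<and>
        rolls_with_initial_speed S N p r \<gamma>3 l3 \<sigma> \<longrightarrow>
        umbilic S N p \<or> mean_curvature S N p = 1 / r)
     \<and>
     (\<forall>h. h = mean_curvature S N p \<and> h \<noteq> 0 \<longrightarrow>
        (umbilic S N p \<longrightarrow>
           (\<forall>r. r \<noteq> 0 \<and> r \<noteq> 1 / h \<longrightarrow> rolls_isotropically S N p r)) \<and>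
        (\<not> umbilic S N p \<longrightarrow>
           rolls_isotropically S N p (1 / h) \<and>
           (\<forall>r. r \<noteq> 0 \<and> r \<noteq> 1 / h \<longrightarrow> \<not> rolls_isotropically S N p r)))"
proof -
  obtain V D e1 e2 a b d where "surface_point S N p V D e1 e2 a b d"
    using surface_point_exists[OF assms(1,3,4)] by metis
  then interpret pt: surface_point S N p V D e1 e2 a b d .
  show ?thesis
  proof (intro conjI allI impI; (elim conjE)?)
    fix r \<sigma> :: real and \<gamma>1 \<gamma>2 \<gamma>3 l1 l2 l3
    assume r: "r \<noteq> 0"
      and \<gamma>1: "unit_speed_curve S l1 \<gamma>1" "\<gamma>1 0 = p"
      and \<gamma>2: "unit_speed_curve S l2 \<gamma>2" "\<gamma>2 0 = p"
      and \<gamma>3: "unit_speed_curve S l3 \<gamma>3" "\<gamma>3 0 = p"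
      and np: "nonparallel (velocity {0..l1} \<gamma>1 0) (velocity {0..l2} \<gamma>2 0)"
        "nonparallel (velocity {0..l1} \<gamma>1 0) (velocity {0..l3} \<gamma>3 0)"
        "nonparallel (velocity {0..l2} \<gamma>2 0) (velocity {0..l3} \<gamma>3 0)"
      and rolls: "rolls_with_initial_speed S N p r \<gamma>1 l1 \<sigma>"
        "rolls_with_initial_speed S N p r \<gamma>2 l2 \<sigma>" "rolls_with_initial_speed S N p r \<gamma>3 l3 \<sigma>"
    obtain x1 y1 where v1: "velocity {0..l1} \<gamma>1 0 = pt.tvec x1 y1" "x1\<^sup>2 + y1\<^sup>2 = 1"
      using pt.unit_speed_velocity[OF \<gamma>1] by blast
    obtain x2 y2 where v2: "velocity {0..l2} \<gamma>2 0 = pt.tvec x2 y2" "x2\<^sup>2 + y2\<^sup>2 = 1"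
      using pt.unit_speed_velocity[OF \<gamma>2] by blast
    obtain x3 y3 where v3: "velocity {0..l3} \<gamma>3 0 = pt.tvec x3 y3" "x3\<^sup>2 + y3\<^sup>2 = 1"
      using pt.unit_speed_velocity[OF \<gamma>3] by blast
    show "umbilic S N p \<or> mean_curvature S N p = 1 / r"
      using pt.equal_speeds_imp[OF r v1(2) v2(2) v3(2) np[unfolded v1 v2 v3, THEN pt.nonparallel_tvec]
          pt.initial_speed_squared[OF r \<gamma>1 v1 rolls(1)] pt.initial_speed_squared[OF r \<gamma>2 v2 rolls(2)]
          pt.initial_speed_squared[OF r \<gamma>3 v3 rolls(3)]] .
  next
    fix h r
    assume "h = mean_curvature S N p" "h \<noteq> 0" "umbilic S N p" "r \<noteq> 0" "r \<noteq> 1 / h"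
    then show "rolls_isotropically S N p r"
      by (intro pt.umbilic_rolls_isotropically) (auto simp: pt.mean_curvature_eq field_simps)
  next
    fix h
    assume "h = mean_curvature S N p" "h \<noteq> 0" "\<not> umbilic S N p"
    then show "rolls_isotropically S N p (1 / h)"
      using pt.nonumbilic_rolls_isotropically by (simp add: pt.mean_curvature_eq)
  next
    fix h r
    assume "h = mean_curvature S N p" "h \<noteq> 0" "\<not> umbilic S N p" "r \<noteq> 0" "r \<noteq> 1 / h"
    then show "\<not> rolls_isotropically S N p r"
      using pt.nonumbilic_rolls_isotropically_imp[of r] by auto
  qed
qed

end
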